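(* Every AT-free outerplanar graph is $B_0$-VPG.
   Context: All graphs are finite and simple. An asteroidal triple (AT) is a set of three pairwise nonadjacent vertices such that between any two of them there is a path avoiding the closed neighborhood of the third; a graph is AT-free if it has no AT. An outerplanar graph is a planar graph with a plane embedding having all vertices on the outer face. A graph is $B_0$-VPG if it is the intersection graph of a family of horizontal or vertical line segments in the plane (point segments allowed): vertices correspond to segments, adjacent iff the segments intersect. *)

theory Defs
  imports "HOL-Analysis.Analysis" "Graph_Theory.Pair_Digraph" "Graph_Theory.Vertex_Walk"
begin

text \<open>Finite simple graphs are symmetric loop-free pair digraphs, i.e. those \<open>G\<close> with
  \<^term>\<open>pair_graph G\<close>; an undirected edge \<open>uv\<close> is the pair of arcs \<open>(u, v)\<close>, \<open>(v, u)\<close>.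
  The plane is the type \<^typ>\<open>complex\<close>.\<close>

definition closed_nbhd :: "'a pair_pre_digraph \<Rightarrow> 'a \<Rightarrow> 'a set" where
  "closed_nbhd G w = insert w {x. (w, x) \<in> parcs G}"

definition path_avoiding_nbhd :: "'a pair_pre_digraph \<Rightarrow> 'a \<Rightarrow> 'a \<Rightarrow> 'a \<Rightarrow> bool" where
  "path_avoiding_nbhd G u v w \<longleftrightarrow>
     (\<exists>p. vpath p (with_proj G) \<and> hd p = u \<and> last p = v \<and> set p \<inter> closed_nbhd G w = {})"

definition asteroidal_triple :: "'a pair_pre_digraph \<Rightarrow> 'a \<Rightarrow> 'a \<Rightarrow> 'a \<Rightarrow> bool" where
  "asteroidal_triple G a b c \<longleftrightarrow>
     {a, b, c} \<subseteq> pverts G \<and> distinct [a, b, c] \<and>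
     (a, b) \<notin> parcs G \<and> (b, c) \<notin> parcs G \<and> (a, c) \<notin> parcs G \<and>
     path_avoiding_nbhd G a b c \<and> path_avoiding_nbhd G b c a \<and> path_avoiding_nbhd G a c b"

definition AT_free :: "'a pair_pre_digraph \<Rightarrow> bool" where
  "AT_free G \<longleftrightarrow> (\<nexists>a b c. asteroidal_triple G a b c)"

text \<open>The two arcs of an undirected edge are drawn as the same curve, traversed in opposite
  directions.\<close>

definition plane_embedding ::
    "'a pair_pre_digraph \<Rightarrow> ('a \<Rightarrow> complex) \<Rightarrow> ('a \<times> 'a \<Rightarrow> real \<Rightarrow> complex) \<Rightarrow> bool" where
  "plane_embedding G pos \<gamma> \<longleftrightarrow>
     inj_on pos (pverts G) \<and>
     (\<forall>(u, v) \<in> parcs G.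
        arc (\<gamma> (u, v)) \<and> pathstart (\<gamma> (u, v)) = pos u \<and> pathfinish (\<gamma> (u, v)) = pos v \<and>
        \<gamma> (v, u) = reversepath (\<gamma> (u, v)) \<and>
        path_image (\<gamma> (u, v)) \<inter> pos ` pverts G = {pos u, pos v}) \<and>
     (\<forall>(u, v) \<in> parcs G. \<forall>(x, y) \<in> parcs G. {u, v} \<noteq> {x, y} \<longrightarrow>
        path_image (\<gamma> (u, v)) \<inter> path_image (\<gamma> (x, y)) \<subseteq> pos ` ({u, v} \<inter> {x, y}))"

definition drawing ::
    "'a pair_pre_digraph \<Rightarrow> ('a \<Rightarrow> complex) \<Rightarrow> ('a \<times> 'a \<Rightarrow> real \<Rightarrow> complex) \<Rightarrow> complex set" where
  "drawing G pos \<gamma> = pos ` pverts G \<union> (\<Union>e \<in> parcs G. path_image (\<gamma> e))"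

text \<open>The drawing of a finite graph is compact, so \<^const>\<open>outside\<close> of it is its unique unbounded
  face; a vertex lies on a face if it belongs to the boundary of that face.\<close>

definition outerplanar :: "'a pair_pre_digraph \<Rightarrow> bool" where
  "outerplanar G \<longleftrightarrow>
     (\<exists>pos \<gamma>. plane_embedding G pos \<gamma> \<and>
        pos ` pverts G \<subseteq> frontier (outside (drawing G pos \<gamma>)))"

definition horizontal_segment :: "complex set \<Rightarrow> bool" where
  "horizontal_segment S \<longleftrightarrow> (\<exists>a b. Im a = Im b \<and> S = closed_segment a b)"

definition vertical_segment :: "complex set \<Rightarrow> bool" where
  "vertical_segment S \<longleftrightarrow> (\<exists>a b. Re a = Re b \<and> S = closed_segment a b)"

definition B0_VPG :: "'a pair_pre_digraph \<Rightarrow> bool" where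
  "B0_VPG G \<longleftrightarrow>
     (\<exists>S. (\<forall>v \<in> pverts G. horizontal_segment (S v) \<or> vertical_segment (S v)) \<and>
        (\<forall>u \<in> pverts G. \<forall>v \<in> pverts G. u \<noteq> v \<longrightarrow>
           ((u, v) \<in> parcs G \<longleftrightarrow> S u \<inter> S v \<noteq> {})))"

end

theory Submission
  imports Defs
begin

text \<open>
  An outerplane graph contains no three internally disjoint paths with common ends and at least
  one inner vertex each, since by Janiszewski's theorem one of them would run inside the closed
  curve formed by the other two; hence there is no \<open>K\<^bsub>2,3\<^esub>\<close> minor, and similarly no \<open>K\<^bsub>4\<^esub>\<close>.

  Call \<open>s\<close> admissible if no two vertices \<open>y\<close>, \<open>z\<close> are such that \<open>s\<close> reaches \<open>y\<close> outside the closed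
  neighbourhood of \<open>z\<close> and reaches \<open>z\<close> outside that of \<open>y\<close>. Every graph without asteroidal triple
  has an admissible vertex. Sweeping the graph from such a vertex, one can add the vertices one by
  one so that at any time at most two vertices \<open>t\<close>, \<open>b\<close> of the processed part have unprocessed
  neighbours, each new vertex replacing \<open>t\<close> or \<open>b\<close>: the sweep gets stuck only if both have two
  unprocessed neighbours, and that violates admissibility or yields a \<open>K\<^bsub>2,3\<^esub>\<close> minor.

  Such a sweep is drawn from left to right, keeping the segments of \<open>t\<close> and \<open>b\<close> extendable.
\<close>

section \<open>Drawings by axis-parallel segments\<close>

text \<open>An active vertex can be replaced only if at most one of its neighbours is unprocessed;
  everything is arranged around this obstacle. Planarity enters only through
  \<open>K23_minor_free\<close> and \<open>K4_free\<close>. The minor is stated with branch sets so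
  that the processed part behind \<open>t\<close> and \<open>b\<close> can be contracted to one of
  them. Admissibility speaks about the start alone, yet it controls late stages: the processed part
  links the start to the active vertices, so an obstruction seen from them is carried back to it. If
  only one active vertex \<open>b\<close> remains, \<open>b\<close> inherits admissibility and the
  past can be forgotten. That stage is the hard one, as \<open>b\<close> may have many unprocessed
  neighbours. Minors and admissibility leave at most two of them leading deeper; minors and the
  absence of asteroidal triples then show that these can be put at the end of the order in which the
  neighbours are consumed. The dummy \<open>None\<close> fills an empty slot, so that starts and new
  components need no separate kind of drawing.\<close>

text \<open>The segment of \<open>a\<close> is the degenerate rectangle with horizontal extent \<open>[l a, r a]\<close> and vertical
  extent \<open>[d a, u a]\<close>.\<close>

definition box_rep ::
    "('b \<Rightarrow> 'b \<Rightarrow> bool) \<Rightarrow> 'b set \<Rightarrow> ('b \<Rightarrow> real) \<Rightarrow> ('b \<Rightarrow> real) \<Rightarrow> ('b \<Rightarrow> real) \<Rightarrow> ('b \<Rightarrow> real) \<Rightarrow> bool"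
  where "box_rep E W l r d u \<longleftrightarrow>
    (\<forall>a\<in>W. l a \<le> r a \<and> d a \<le> u a \<and> (l a = r a \<or> d a = u a)) \<and>
    (\<forall>a\<in>W. \<forall>b\<in>W. a \<noteq> b \<longrightarrow>
      (E a b \<longleftrightarrow> l a \<le> r b \<and> l b \<le> r a \<and> d a \<le> u b \<and> d b \<le> u a))"

text \<open>The forms below describe in which ways the segments of the two active vertices \<open>t\<close>, \<open>b\<close> can still
  be extended. Pairwise intersecting segments have a common point, so a new vertex adjacent to both of
  two perpendicular segments has to cover their corner; it can do so while avoiding all other segments
  only in the free corner form, where the rays from the corner to the right and downwards meet no other
  segment. Conversely, a vertex adjacent to \<open>t\<close> but not to \<open>b\<close> cannot be added when both are collinear.
  This is why \<open>drawable\<close> asks for two different drawings when \<open>t\<close> and \<open>b\<close> are adjacent.\<close>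

definition right_form :: "('b \<Rightarrow> 'b \<Rightarrow> bool) \<Rightarrow> 'b set \<Rightarrow> 'b \<Rightarrow> bool" where
  "right_form E W b \<longleftrightarrow> (\<exists>l r d u. box_rep E W l r d u \<and> b \<in> W \<and> d b = u b \<and>
     (\<forall>w\<in>W - {b}. r w < r b))"

definition parallel_form :: "('b \<Rightarrow> 'b \<Rightarrow> bool) \<Rightarrow> 'b set \<Rightarrow> 'b \<Rightarrow> 'b \<Rightarrow> bool" where
  "parallel_form E W t b \<longleftrightarrow> (\<exists>l r d u. box_rep E W l r d u \<and> t \<in> W \<and> b \<in> W \<and> t \<noteq> b \<and>
     d t = u t \<and> d b = u b \<and> r t = r b \<and> (\<forall>w\<in>W - {t, b}. r w < r b))"

definition corner_form :: "('b \<Rightarrow> 'b \<Rightarrow> bool) \<Rightarrow> 'b set \<Rightarrow> 'b \<Rightarrow> 'b \<Rightarrow> bool" where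
  "corner_form E W t b \<longleftrightarrow> (\<exists>l r d u. box_rep E W l r d u \<and> t \<in> W \<and> b \<in> W \<and> t \<noteq> b \<and>
     l t = r t \<and> d b = u b \<and> (\<forall>w\<in>W - {b}. r w < r b) \<and> (\<forall>w\<in>W - {t}. d t < d w))"

definition free_corner_form :: "('b \<Rightarrow> 'b \<Rightarrow> bool) \<Rightarrow> 'b set \<Rightarrow> 'b \<Rightarrow> 'b \<Rightarrow> bool" where
  "free_corner_form E W t b \<longleftrightarrow> (\<exists>l r d u. box_rep E W l r d u \<and> t \<in> W \<and> b \<in> W \<and> t \<noteq> b \<and>
     l t = r t \<and> d b = u b \<and> r b = r t \<and> d b = d t \<and>
     (\<forall>w\<in>W - {t, b}. \<not> (d w \<le> d b \<and> d b \<le> u w \<and> r t \<le> r w) \<and>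
                      \<not> (l w \<le> r t \<and> r t \<le> r w \<and> d w \<le> d b)))"

definition drawable :: "('b \<Rightarrow> 'b \<Rightarrow> bool) \<Rightarrow> 'b set \<Rightarrow> 'b \<Rightarrow> 'b \<Rightarrow> bool" where
  "drawable E W t b \<longleftrightarrow>
     (if E t b then parallel_form E W t b \<and> corner_form E W t b \<or> free_corner_form E W t b
      else parallel_form E W t b)"

lemma box_repD:
  assumes "box_rep E W l r d u" "a \<in> W"
  shows "l a \<le> r a" "d a \<le> u a" "l a = r a \<or> d a = u a"
  using assms by (auto simp: box_rep_def)

lemma box_rep_adjacent_iff:
  assumes "box_rep E W l r d u" "a \<in> W" "b \<in> W" "a \<noteq> b"
  shows "E a b \<longleftrightarrow> l a \<le> r b \<and> l b \<le> r a \<and> d a \<le> u b \<and> d b \<le> u a"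
  using assms by (simp add: box_rep_def)

lemma box_rep_insert:
  assumes "box_rep E W l r d u" "v \<notin> W" "symp E"
    and "l0 \<le> r0" "d0 \<le> u0" "l0 = r0 \<or> d0 = u0"
    and "\<And>w. w \<in> W \<Longrightarrow> E v w \<longleftrightarrow> l0 \<le> r w \<and> l w \<le> r0 \<and> d0 \<le> u w \<and> d w \<le> u0"
  shows "box_rep E (insert v W) (l(v := l0)) (r(v := r0)) (d(v := d0)) (u(v := u0))"
proof -
  have 1: "E v w \<longleftrightarrow> l0 \<le> r w \<and> l w \<le> r0 \<and> d0 \<le> u w \<and> d w \<le> u0"
    and 2: "E w v \<longleftrightarrow> l0 \<le> r w \<and> l w \<le> r0 \<and> d0 \<le> u w \<and> d w \<le> u0" if "w \<in> W" for w
    using assms(7)[OF that] sympD[OF \<open>symp E\<close>] by blast+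
  show ?thesis
    using assms(1,2,4,5,6) 1 2 unfolding box_rep_def by auto
qed

text \<open>A segment that meets only the new piece of \<open>b\<close> spans the height of
  \<open>b\<close> and ends no earlier than \<open>r b\<close>. The last hypothesis makes it a
  neighbour of \<open>b\<close>, so it met \<open>b\<close> before. Hence no intersection is
  new.\<close>

lemma box_rep_extend_right:
  assumes "box_rep E W l r d u" "b \<in> W" "symp E" "d b = u b" "r b \<le> M"
    and "\<And>w. w \<in> W \<Longrightarrow> w \<noteq> b \<Longrightarrow> d w \<le> d b \<Longrightarrow> d b \<le> u w \<Longrightarrow> r b \<le> r w \<Longrightarrow> E b w"
  shows "box_rep E W l (r(b := M)) d u"
proof -
  have 1: "E b w \<longleftrightarrow> l b \<le> r w \<and> l w \<le> M \<and> d b \<le> u w \<and> d w \<le> u b"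
    and 2: "E w b \<longleftrightarrow> l b \<le> r w \<and> l w \<le> M \<and> d b \<le> u w \<and> d w \<le> u b"
    if "w \<in> W" "w \<noteq> b" for w
  proof -
    have old: "E b w \<longleftrightarrow> l b \<le> r w \<and> l w \<le> r b \<and> d b \<le> u w \<and> d w \<le> u b"
      using box_rep_adjacent_iff[OF assms(1,2) that(1)] that by blast
    have "l w \<le> r w" using that assms(1) by (auto simp: box_rep_def)
    then show 1: "E b w \<longleftrightarrow> l b \<le> r w \<and> l w \<le> M \<and> d b \<le> u w \<and> d w \<le> u b"
      using old assms(4,5) assms(6)[OF that] by auto
    then show "E w b \<longleftrightarrow> l b \<le> r w \<and> l w \<le> M \<and> d b \<le> u w \<and> d w \<le> u b"
      using sympD[OF \<open>symp E\<close>] by blast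
  qed
  have 3: "l b \<le> M" using assms(1,2,5) unfolding box_rep_def by force
  show ?thesis
    using assms(1,2,4) 1 2 3 unfolding box_rep_def by auto
qed

text \<open>This is the reflection taking (x, y) to (-y, -x). It exchanges the directions right and
  down, hence the roles of \<open>t\<close> and \<open>b\<close> in both corner forms.\<close>

lemma box_rep_reflect:
  assumes "box_rep E W l r d u"
  shows "box_rep E W (\<lambda>a. - u a) (\<lambda>a. - d a) (\<lambda>a. - r a) (\<lambda>a. - l a)"
  using assms unfolding box_rep_def by auto

lemma box_rep_flip:
  assumes "box_rep E W l r d u"
  shows "box_rep E W l r (\<lambda>a. - u a) (\<lambda>a. - d a)"
  using assms unfolding box_rep_def by auto

lemma box_rep_extend_down:
  assumes "box_rep E W l r d u" "t \<in> W" "symp E" "l t = r t" "N \<le> d t"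
    and "\<And>w. w \<in> W \<Longrightarrow> w \<noteq> t \<Longrightarrow> l w \<le> l t \<Longrightarrow> l t \<le> r w \<Longrightarrow> d w \<le> d t \<Longrightarrow> E t w"
  shows "box_rep E W l r (d(t := N)) u"
proof -
  have "box_rep E W (\<lambda>a. - u a) ((\<lambda>a. - d a)(t := - N)) (\<lambda>a. - r a) (\<lambda>a. - l a)"
    by (rule box_rep_extend_right[OF box_rep_reflect[OF assms(1)]]) (use assms in auto)
  from box_rep_reflect[OF this] show ?thesis
    by (simp add: fun_upd_def if_distrib cong: if_cong)
qed

lemma ex_upper_bound: "finite W \<Longrightarrow> \<exists>M. \<forall>w\<in>W. f w < (M::real)"
  by (metis finite_imageI image_eqI bdd_above_finite bdd_above.unfold le_less_trans gt_ex)

lemma ex_lower_bound: "finite W \<Longrightarrow> \<exists>M. \<forall>w\<in>W. (M::real) < f w"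
  using ex_upper_bound[of W "\<lambda>w. - f w"] by (metis minus_less_iff)

lemma parallel_form_commute:
  assumes "parallel_form E W t b" shows "parallel_form E W b t"
proof -
  obtain l r d u where h: "box_rep E W l r d u \<and> t \<in> W \<and> b \<in> W \<and> t \<noteq> b \<and>
     d t = u t \<and> d b = u b \<and> r t = r b \<and> (\<forall>w\<in>W - {t, b}. r w < r b)"
    using assms(1) unfolding parallel_form_def by blast
  show ?thesis unfolding parallel_form_def
    by (rule exI[of _ l], rule exI[of _ r], rule exI[of _ d], rule exI[of _ u])
       (use h in auto)
qed

lemma corner_form_commute:
  assumes "corner_form E W t b" shows "corner_form E W b t"
proof -
  obtain l r d u where h: "box_rep E W l r d u \<and> t \<in> W \<and> b \<in> W \<and> t \<noteq> b \<and>
     l t = r t \<and> d b = u b \<and> (\<forall>w\<in>W - {b}. r w < r b) \<and> (\<forall>w\<in>W - {t}. d t < d w)"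
    using assms(1) unfolding corner_form_def by blast
  show ?thesis unfolding corner_form_def
    by (rule exI[of _ "\<lambda>a. - u a"], rule exI[of _ "\<lambda>a. - d a"], rule exI[of _ "\<lambda>a. - r a"],
        rule exI[of _ "\<lambda>a. - l a"]) (use h box_rep_reflect in auto)
qed

lemma free_corner_form_commute:
  assumes "free_corner_form E W t b" shows "free_corner_form E W b t"
proof -
  obtain l r d u where h: "box_rep E W l r d u \<and> t \<in> W \<and> b \<in> W \<and> t \<noteq> b \<and>
     l t = r t \<and> d b = u b \<and> r b = r t \<and> d b = d t \<and>
     (\<forall>w\<in>W - {t, b}. \<not> (d w \<le> d b \<and> d b \<le> u w \<and> r t \<le> r w) \<and>
                      \<not> (l w \<le> r t \<and> r t \<le> r w \<and> d w \<le> d b))"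
    using assms(1) unfolding free_corner_form_def by blast
  show ?thesis unfolding free_corner_form_def
    by (rule exI[of _ "\<lambda>a. - u a"], rule exI[of _ "\<lambda>a. - d a"], rule exI[of _ "\<lambda>a. - r a"],
        rule exI[of _ "\<lambda>a. - l a"]) (use h box_rep_reflect in auto)
qed

lemma drawable_commute:
  assumes "symp E" "drawable E W t b" shows "drawable E W b t"
  using assms parallel_form_commute[of E W t b] corner_form_commute[of E W t b]
    free_corner_form_commute[of E W t b] sympD[OF assms(1), of b t] sympD[OF assms(1), of t b]
  unfolding drawable_def by (auto split: if_splits)

section \<open>Adding one vertex to a drawing\<close>

context
  fixes E :: "'b \<Rightarrow> 'b \<Rightarrow> bool" and W :: "'b set" and v :: 'b
  assumes symE: "symp E" and finW: "finite W" and v: "v \<notin> W"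
begin

text \<open>The two empty rays leave room to prolong \<open>b\<close> to the right and
  \<open>t\<close> downwards beyond all other segments.\<close>

lemma corner_form_if_free_corner_form:
  assumes "free_corner_form E W t b" "E t b"
  shows "corner_form E W t b"
proof -
  obtain l r d u where h: "box_rep E W l r d u" "t \<in> W" "b \<in> W" "t \<noteq> b"
     "l t = r t" "d b = u b" "r b = r t" "d b = d t"
     and f1: "\<And>w. w\<in>W - {t, b} \<Longrightarrow> \<not> (d w \<le> d b \<and> d b \<le> u w \<and> r t \<le> r w)"
     and f2: "\<And>w. w\<in>W - {t, b} \<Longrightarrow> \<not> (l w \<le> r t \<and> r t \<le> r w \<and> d w \<le> d b)"
    using assms(1) unfolding free_corner_form_def by blast
  obtain M where M: "\<forall>w\<in>W. r w < M" using ex_upper_bound[OF finW] by blast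
  obtain N where N: "\<forall>w\<in>W. N < d w" using ex_lower_bound[OF finW] by blast
  have E: "E b t" using symE assms(2) by (auto dest: sympD)
  have 1: "box_rep E W l (r(b := M)) d u"
    by (rule box_rep_extend_right[OF h(1) h(3) symE]) (use h M E f1 in force)+
  have 2: "box_rep E W l (r(b := M)) (d(t := N)) u"
    by (rule box_rep_extend_down[OF 1 h(2) symE]) (use h N assms f2 in \<open>force split: if_splits\<close>)+
  show ?thesis
    unfolding corner_form_def
    by (rule exI[of _ l], rule exI[of _ "r(b := M)"], rule exI[of _ "d(t := N)"], rule exI[of _ u])
       (use 2 h M N in auto)
qed

text \<open>Only \<open>t\<close> ends as far to the right as \<open>b\<close>. It obstructs
  prolonging \<open>b\<close> only if both have the same height; then they already share their right
  end, so they are adjacent.\<close>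

lemma right_form_if_parallel_form:
  assumes "parallel_form E W t b" shows "right_form E W b"
proof -
  obtain l r d u where h: "box_rep E W l r d u" "t \<in> W" "b \<in> W" "t \<noteq> b"
     "d t = u t" "d b = u b" "r t = r b" "\<And>w. w\<in>W - {t, b} \<Longrightarrow> r w < r b"
    using assms(1) unfolding parallel_form_def by blast
  have lr: "l b \<le> r b" "l t \<le> r t" using h(1-3) by (auto simp: box_rep_def)
  have lt: "r w < r b + 1" if "w \<in> W" for w
    using h(7) h(8)[of w] that by (cases "w = t"; cases "w = b") auto
  have E: "E b t" if "d b = d t"
  proof -
    have "E b t \<longleftrightarrow> l b \<le> r t \<and> l t \<le> r b \<and> d b \<le> u t \<and> d t \<le> u b"
      using box_rep_adjacent_iff[OF h(1)] h(2-4) by blast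
    then show ?thesis using that h lr by auto
  qed
  have 1: "box_rep E W l (r(b := r b + 1)) d u"
  proof (rule box_rep_extend_right[OF h(1) h(3) symE h(6)])
    fix w assume w: "w \<in> W" "w \<noteq> b" "d w \<le> d b" "d b \<le> u w" "r b \<le> r w"
    then have "w = t" using h(8)[of w] by force
    with w show "E b w" using E h by auto
  qed simp
  have "\<forall>w\<in>W - {b}. (r(b := r b + 1)) w < (r(b := r b + 1)) b"
    using lt by auto
  with 1 show ?thesis unfolding right_form_def using h by blast
qed

lemma right_form_if_corner_form: "corner_form E W t b \<Longrightarrow> right_form E W b"
  unfolding corner_form_def right_form_def by blast

lemma right_form_if_drawable:
  assumes "drawable E W t b" shows "right_form E W b"
  using assms right_form_if_corner_form corner_form_if_free_corner_form right_form_if_parallel_form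
  unfolding drawable_def by (meson)

lemma corner_form_if_drawable:
  assumes "drawable E W t b" "E t b" shows "corner_form E W t b"
  using assms corner_form_if_free_corner_form unfolding drawable_def by meson

text \<open>Only \<open>b\<close> reaches the abscissa \<open>r b\<close>, so a point there at any
  other height is isolated.\<close>

lemma add_isolated:
  assumes "right_form E W b" "\<And>w. w \<in> W \<Longrightarrow> \<not> E v w"
  shows "parallel_form E (insert v W) v b"
proof -
  obtain l r d u where h: "box_rep E W l r d u" "b \<in> W" "d b = u b" "\<And>w. w\<in>W - {b} \<Longrightarrow> r w < r b"
    using assms(1) unfolding right_form_def by blast
  have 1: "box_rep E (insert v W) (l(v := r b)) (r(v := r b)) (d(v := d b + 1)) (u(v := d b + 1))"
  proof (rule box_rep_insert[OF h(1) v symE])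
    fix w assume "w \<in> W"
    then show "E v w = (r b \<le> r w \<and> l w \<le> r b \<and> d b + 1 \<le> u w \<and> d w \<le> d b + 1)"
      using assms(2)[of w] h(3) h(4)[of w] by (cases "w = b") auto
  qed auto
  show ?thesis unfolding parallel_form_def
    by (intro exI conjI, rule 1) (use h v in auto)
qed

text \<open>The right end of \<open>b\<close>, taken as a point segment, meets \<open>b\<close>
  alone.\<close>

lemma add_pendant_parallel:
  assumes "right_form E W b" "E v b" "\<And>w. w \<in> W \<Longrightarrow> E v w \<Longrightarrow> w = b"
  shows "parallel_form E (insert v W) v b"
proof -
  have nv: "w \<in> W \<Longrightarrow> w \<noteq> b \<Longrightarrow> \<not> E v w" for w using assms(3) by blast
  obtain l r d u where h: "box_rep E W l r d u" "b \<in> W" "d b = u b" "\<And>w. w\<in>W - {b} \<Longrightarrow> r w < r b"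
    using assms(1) unfolding right_form_def by blast
  have 1: "box_rep E (insert v W) (l(v := r b)) (r(v := r b)) (d(v := d b)) (u(v := d b))"
  proof (rule box_rep_insert[OF h(1) v symE])
    fix w assume "w \<in> W"
    then show "E v w = (r b \<le> r w \<and> l w \<le> r b \<and> d b \<le> u w \<and> d w \<le> d b)"
      using assms(2) nv[of w] h(3) h(4)[of w] box_repD[OF h(1) h(2)] by (cases "w = b") auto
  qed auto
  show ?thesis unfolding parallel_form_def
    by (intro exI conjI, rule 1) (use h v in auto)
qed

text \<open>The new segment hangs from the former right end of \<open>b\<close> to below the whole
  drawing; \<open>b\<close> is prolonged by 1 so that it still ends strictly last.\<close>

lemma add_pendant_corner:
  assumes "right_form E W b" "E v b" "\<And>w. w \<in> W \<Longrightarrow> E v w \<Longrightarrow> w = b"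
  shows "corner_form E (insert v W) v b"
proof -
  have nv: "w \<in> W \<Longrightarrow> w \<noteq> b \<Longrightarrow> \<not> E v w" for w using assms(3) by blast
  obtain l r d u where h: "box_rep E W l r d u" "b \<in> W" "d b = u b" "\<And>w. w\<in>W - {b} \<Longrightarrow> r w < r b"
    using assms(1) unfolding right_form_def by blast
  obtain N where N: "\<forall>w\<in>W. N < d w" using ex_lower_bound[OF finW] by blast
  have lt: "r w < r b + 1" if "w \<in> W" for w
    using h(4)[of w] that by (cases "w = b") auto
  have 0: "box_rep E W l (r(b := r b + 1)) d u"
    by (rule box_rep_extend_right[OF h(1) h(2) symE h(3)]) (use h(4) in force)+
  have 1: "box_rep E (insert v W) (l(v := r b)) (r(b := r b + 1, v := r b)) (d(v := N)) (u(v := d b))"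
  proof (rule box_rep_insert[OF 0 v symE])
    show "N \<le> d b" using N h(2) by (simp add: less_imp_le)
    fix w assume "w \<in> W"
    then show "E v w = (r b \<le> (r(b := r b + 1)) w \<and> l w \<le> r b \<and> N \<le> u w \<and> d w \<le> d b)"
      using assms(2) nv[of w] h(3) h(4)[of w] box_repD[OF h(1) h(2)] N h(2)
      by (cases "w = b") (auto simp: less_imp_le)
  qed auto
  show ?thesis unfolding corner_form_def
    by (intro exI conjI, rule 1) (use h v N lt in auto)
qed

text \<open>Nonadjacent \<open>t\<close> and \<open>b\<close> with a common right abscissa have
  different heights. So \<open>v\<close> can continue \<open>t\<close> along its line while
  \<open>b\<close> is prolonged by the same amount.\<close>

lemma add_parallel_to_front:
  assumes "parallel_form E W t b" "\<not> E t b" "E v t" "\<not> E v b"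
    "\<And>w. w \<in> W \<Longrightarrow> E v w \<Longrightarrow> w = t"
  shows "parallel_form E (insert v W) v b"
proof -
  have nv: "w \<in> W \<Longrightarrow> w \<noteq> t \<Longrightarrow> \<not> E v w" for w using assms(5) by blast
  obtain l r d u where h: "box_rep E W l r d u" "t \<in> W" "b \<in> W" "t \<noteq> b"
     "d t = u t" "d b = u b" "r t = r b" "\<And>w. w\<in>W - {t, b} \<Longrightarrow> r w < r b"
    using assms(1) unfolding parallel_form_def by blast
  have lr: "l b \<le> r b" "l t \<le> r t" using h(1-3) by (auto simp: box_rep_def)
  have lt: "r w < r b + 1" if "w \<in> W" for w
    using h(7) h(8)[of w] that by (cases "w = t"; cases "w = b") auto
  have ne: "d b \<noteq> d t"
  proof -
    have "E t b \<longleftrightarrow> l t \<le> r b \<and> l b \<le> r t \<and> d t \<le> u b \<and> d b \<le> u t"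
      using box_rep_adjacent_iff[OF h(1)] h(2-4) by blast
    then show ?thesis using h lr assms(2) by auto
  qed
  have 0: "box_rep E W l (r(b := r b + 1)) d u"
  proof (rule box_rep_extend_right[OF h(1) h(3) symE h(6)])
    fix w assume w: "w \<in> W" "w \<noteq> b" "d w \<le> d b" "d b \<le> u w" "r b \<le> r w"
    then have "w = t" using h(8)[of w] by force
    with w show "E b w" using ne h by auto
  qed simp
  have 1: "box_rep E (insert v W) (l(v := r b)) (r(b := r b + 1, v := r b + 1)) (d(v := d t)) (u(v := d t))"
  proof (rule box_rep_insert[OF 0 v symE])
    fix w assume "w \<in> W"
    then show "E v w = (r b \<le> (r(b := r b + 1)) w \<and> l w \<le> r b + 1 \<and> d t \<le> u w \<and> d w \<le> d t)"
      using assms(3,4) nv[of w] h(4-7) h(8)[of w] lr ne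
      by (cases "w = b"; cases "w = t") auto
  qed auto
  show ?thesis unfolding parallel_form_def
    by (intro exI conjI, rule 1) (use h v lt in auto)
qed

text \<open>Only \<open>t\<close> reaches down to the level \<open>d t\<close>. Along it
  \<open>v\<close> runs from the foot of \<open>t\<close> to the abscissa of the right end of
  \<open>b\<close>.\<close>

lemma add_below_corner:
  assumes "corner_form E W t b" "E v t" "\<not> E v b" "\<And>w. w \<in> W \<Longrightarrow> E v w \<Longrightarrow> w = t"
  shows "parallel_form E (insert v W) v b"
proof -
  have nv: "w \<in> W \<Longrightarrow> w \<noteq> t \<Longrightarrow> \<not> E v w" for w using assms(4) by blast
  obtain l r d u where h: "box_rep E W l r d u" "t \<in> W" "b \<in> W" "t \<noteq> b"
     "l t = r t" "d b = u b" "\<And>w. w\<in>W - {b} \<Longrightarrow> r w < r b" "\<And>w. w\<in>W - {t} \<Longrightarrow> d t < d w"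
    using assms(1) unfolding corner_form_def by blast
  have 1: "box_rep E (insert v W) (l(v := l t)) (r(v := r b)) (d(v := d t)) (u(v := d t))"
  proof (rule box_rep_insert[OF h(1) v symE])
    show "l t \<le> r b" using h(7)[of t] h(2,4,5) by auto
    fix w assume w: "w \<in> W"
    then show "E v w = (l t \<le> r w \<and> l w \<le> r b \<and> d t \<le> u w \<and> d w \<le> d t)"
      using assms(2) nv[of w] h(4-6) h(7)[of w] h(8)[of w] h(7)[of t] h(2) box_repD[OF h(1) h(2)]
      by (cases "w = t") auto
  qed auto
  show ?thesis unfolding parallel_form_def
    by (intro exI conjI, rule 1) (use h v in auto)
qed

text \<open>A vertical bridge between the right ends of \<open>t\<close> and \<open>b\<close> meets
  nothing else, and its lower end, on \<open>b\<close>, is a free corner.\<close>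

lemma add_across_parallel:
  assumes "parallel_form E W t b" "\<not> E t b" "E v t" "E v b"
    "\<And>w. w \<in> W \<Longrightarrow> E v w \<Longrightarrow> w = t \<or> w = b"
  shows "free_corner_form E (insert v W) v b"
proof -
  have nv: "w \<in> W \<Longrightarrow> w \<noteq> t \<Longrightarrow> w \<noteq> b \<Longrightarrow> \<not> E v w" for w using assms(5) by blast
  obtain l r d u where h: "box_rep E W l r d u" "t \<in> W" "b \<in> W" "t \<noteq> b"
     "d t = u t" "d b = u b" "r t = r b" "\<And>w. w\<in>W - {t, b} \<Longrightarrow> r w < r b"
     and gt: "d b < d t"
  proof -
    obtain l r d u where h: "box_rep E W l r d u" "t \<in> W" "b \<in> W" "t \<noteq> b"
       "d t = u t" "d b = u b" "r t = r b" "\<And>w. w\<in>W - {t, b} \<Longrightarrow> r w < r b"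
      using assms(1) unfolding parallel_form_def by blast
    have lr: "l b \<le> r b" "l t \<le> r t" using h(1-3) by (auto simp: box_rep_def)
  have lt: "r w < r b + 1" if "w \<in> W" for w
    using h(7) h(8)[of w] that by (cases "w = t"; cases "w = b") auto
    have "E t b \<longleftrightarrow> l t \<le> r b \<and> l b \<le> r t \<and> d t \<le> u b \<and> d b \<le> u t"
      using box_rep_adjacent_iff[OF h(1)] h(2-4) by blast
    \<comment> \<open>If \<open>t\<close> lies below \<open>b\<close>, the drawing is turned upside
      down.\<close>
    then have "d b < d t \<or> - d b < - d t" using h lr assms(2) by auto
    then show thesis
      using that[OF h] that[OF box_rep_flip[OF h(1)]] h by auto
  qed
  have lr: "l b \<le> r b" "l t \<le> r t" using h(1-3) by (auto simp: box_rep_def)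
  have lt: "r w < r b + 1" if "w \<in> W" for w
    using h(7) h(8)[of w] that by (cases "w = t"; cases "w = b") auto
  have 1: "box_rep E (insert v W) (l(v := r b)) (r(v := r b)) (d(v := d b)) (u(v := d t))"
  proof (rule box_rep_insert[OF h(1) v symE])
    fix w assume w: "w \<in> W"
    then show "E v w = (r b \<le> r w \<and> l w \<le> r b \<and> d b \<le> u w \<and> d w \<le> d t)"
      using assms(3,4) nv[of w] h(4-7) h(8)[of w] lr gt
      by (cases "w = b"; cases "w = t") auto
  qed (use gt in auto)
  have ne: "b \<noteq> v" "t \<noteq> v" using h(2,3) v by auto
  have lt': "\<not> (d w \<le> u b \<and> r b \<le> r w)" if "w \<in> W" "w \<noteq> b" for w
    using h(5-7) h(8)[of w] that gt by (cases "w = t") auto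
  show ?thesis unfolding free_corner_form_def
    by (intro exI conjI, rule 1) (use h(2-7) v gt ne lt' in auto)
qed

text \<open>Adjacent parallel \<open>t\<close> and \<open>b\<close> are collinear and share their
  right end. From this point \<open>v\<close> runs to the right along \<open>b\<close> or straight
  down, which yields the two forms that \<open>drawable\<close> asks for.\<close>

lemma add_triangle_parallel:
  assumes "parallel_form E W t b" "E t b" "E v t" "E v b"
    "\<And>w. w \<in> W \<Longrightarrow> E v w \<Longrightarrow> w = t \<or> w = b"
  shows "parallel_form E (insert v W) v b" "corner_form E (insert v W) v b"
proof -
  have nv: "w \<in> W \<Longrightarrow> w \<noteq> t \<Longrightarrow> w \<noteq> b \<Longrightarrow> \<not> E v w" for w using assms(5) by blast
  obtain l r d u where h: "box_rep E W l r d u" "t \<in> W" "b \<in> W" "t \<noteq> b"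
     "d t = u t" "d b = u b" "r t = r b" "\<And>w. w\<in>W - {t, b} \<Longrightarrow> r w < r b"
    using assms(1) unfolding parallel_form_def by blast
  obtain N where N: "\<forall>w\<in>W. N < d w" using ex_lower_bound[OF finW] by blast
  have lr: "l b \<le> r b" "l t \<le> r t" using h(1-3) by (auto simp: box_rep_def)
  have lt: "r w < r b + 1" if "w \<in> W" for w
    using h(7) h(8)[of w] that by (cases "w = t"; cases "w = b") auto
  have eq: "d b = d t"
  proof -
    have "E t b \<longleftrightarrow> l t \<le> r b \<and> l b \<le> r t \<and> d t \<le> u b \<and> d b \<le> u t"
      using box_rep_adjacent_iff[OF h(1)] h(2-4) by blast
    then show ?thesis using h lr assms(2) by auto
  qed
  have 0: "box_rep E W l (r(b := r b + 1)) d u"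
  proof (rule box_rep_extend_right[OF h(1) h(3) symE h(6)])
    fix w assume w: "w \<in> W" "w \<noteq> b" "d w \<le> d b" "d b \<le> u w" "r b \<le> r w"
    then have "w = t" using h(8)[of w] by force
    with w show "E b w" using assms(2) symE by (auto dest: sympD)
  qed simp
  have 1: "box_rep E (insert v W) (l(v := r b)) (r(b := r b + 1, v := r b + 1)) (d(v := d b)) (u(v := d b))"
  proof (rule box_rep_insert[OF 0 v symE])
    fix w assume "w \<in> W"
    then show "E v w = (r b \<le> (r(b := r b + 1)) w \<and> l w \<le> r b + 1 \<and> d b \<le> u w \<and> d w \<le> d b)"
      using assms(3,4) nv[of w] h(4-7) h(8)[of w] lr eq
      by (cases "w = b"; cases "w = t") auto
  qed auto
  show "parallel_form E (insert v W) v b" unfolding parallel_form_def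
    by (intro exI conjI, rule 1) (use h v lt in auto)
  have 2: "box_rep E (insert v W) (l(v := r b)) (r(b := r b + 1, v := r b)) (d(v := N)) (u(v := d b))"
  proof (rule box_rep_insert[OF 0 v symE])
    show "N \<le> d b" using N h(3) by (simp add: less_imp_le)
    fix w assume "w \<in> W"
    then show "E v w = (r b \<le> (r(b := r b + 1)) w \<and> l w \<le> r b \<and> N \<le> u w \<and> d w \<le> d b)"
      using assms(3,4) nv[of w] h(4-7) h(8)[of w] lr eq N
      by (cases "w = b"; cases "w = t") (auto simp: less_imp_le)
  qed auto
  show "corner_form E (insert v W) v b" unfolding corner_form_def
    by (intro exI conjI, rule 2) (use h v N lt in auto)
qed

text \<open>Both drawings of \<open>v\<close> start at the corner: one follows the free ray to the
  right, the other the free ray downwards.\<close>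

lemma add_triangle_free_corner:
  assumes "free_corner_form E W t b" "E t b" "E v t" "E v b"
    "\<And>w. w \<in> W \<Longrightarrow> E v w \<Longrightarrow> w = t \<or> w = b"
  shows "parallel_form E (insert v W) v b" "corner_form E (insert v W) v b"
proof -
  have nv: "w \<in> W \<Longrightarrow> w \<noteq> t \<Longrightarrow> w \<noteq> b \<Longrightarrow> \<not> E v w" for w using assms(5) by blast
  obtain l r d u where h: "box_rep E W l r d u" "t \<in> W" "b \<in> W" "t \<noteq> b"
     "l t = r t" "d b = u b" "r b = r t" "d b = d t"
     and f1: "\<And>w. w\<in>W - {t, b} \<Longrightarrow> \<not> (d w \<le> d b \<and> d b \<le> u w \<and> r t \<le> r w)"
     and f2: "\<And>w. w\<in>W - {t, b} \<Longrightarrow> \<not> (l w \<le> r t \<and> r t \<le> r w \<and> d w \<le> d b)"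
    using assms(1) unfolding free_corner_form_def by blast
  obtain M where M: "\<forall>w\<in>W. r w < M" using ex_upper_bound[OF finW] by blast
  obtain N where N: "\<forall>w\<in>W. N < d w" using ex_lower_bound[OF finW] by blast
  have E: "E b t" using symE assms(2) by (auto dest: sympD)
  have ud: "l w \<le> r w" "d w \<le> u w" if "w \<in> W" for w using h(1) that by (auto simp: box_rep_def)
  have 0: "box_rep E W l (r(b := M)) d u"
    by (rule box_rep_extend_right[OF h(1) h(3) symE]) (use h M E f1 in force)+
  have 1: "box_rep E (insert v W) (l(v := r t)) (r(b := M, v := M)) (d(v := d b)) (u(v := d b))"
  proof (rule box_rep_insert[OF 0 v symE])
    show "r t \<le> M" using M h(2) by (simp add: less_imp_le)
    fix w assume "w \<in> W"
    then show "E v w = (r t \<le> (r(b := M)) w \<and> l w \<le> M \<and> d b \<le> u w \<and> d w \<le> d b)"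
      using assms(3,4) nv[of w] h(4-8) f1[of w] ud[of w] M ud[OF h(2)] M[rule_format, OF h(2)]
        M[rule_format, of w]
      by (cases "w = b"; cases "w = t") auto
  qed auto
  show "parallel_form E (insert v W) v b" unfolding parallel_form_def
    by (intro exI conjI, rule 1) (use h v M in auto)
  have 2: "box_rep E (insert v W) (l(v := r t)) (r(b := M, v := r t)) (d(v := N)) (u(v := d b))"
  proof (rule box_rep_insert[OF 0 v symE])
    show "N \<le> d b" using N h(3) by (simp add: less_imp_le)
    fix w assume w: "w \<in> W"
    then show "E v w = (r t \<le> (r(b := M)) w \<and> l w \<le> r t \<and> N \<le> u w \<and> d w \<le> d b)"
      using assms(3,4) nv[of w] h(4-8) f2[of w] ud[of w] ud[OF h(3)] M[rule_format, OF h(2)]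
        N[rule_format, of w] ud[OF h(2)]
      by (cases "w = b"; cases "w = t") auto
  qed auto
  show "corner_form E (insert v W) v b" unfolding corner_form_def
    by (intro exI conjI, rule 2) (use h v N M in auto)
qed

lemma drawable_insert:
  assumes "drawable E W t b" "\<And>w. w \<in> W \<Longrightarrow> E v w \<Longrightarrow> w = t \<or> w = b"
  shows "drawable E (insert v W) v b"
proof -
  note R = right_form_if_drawable[OF assms(1)]
  consider "\<not> E v t" "\<not> E v b" | "\<not> E v t" "E v b" | "E v t" "\<not> E v b" | "E v t" "E v b" by blast
  then show ?thesis
  proof cases
    case 1 then have "parallel_form E (insert v W) v b" using add_isolated[OF R] assms(2) by blast
    with 1 show ?thesis by (simp add: drawable_def)
  next
    case 2
    then have "parallel_form E (insert v W) v b" "corner_form E (insert v W) v b"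
      using add_pendant_parallel[OF R] add_pendant_corner[OF R] assms(2) by blast+
    with 2 show ?thesis by (simp add: drawable_def)
  next
    case 3
    have "parallel_form E (insert v W) v b"
    proof (cases "E t b")
      case True
      show ?thesis
        using add_below_corner[OF corner_form_if_drawable[OF assms(1) True] 3] 3 assms(2) by blast
    next
      case False
      then have "parallel_form E W t b" using assms(1) by (simp add: drawable_def)
      from add_parallel_to_front[OF this False 3] show ?thesis using 3 assms(2) by blast
    qed
    with 3 show ?thesis by (simp add: drawable_def)
  next
    case 4
    show ?thesis
    proof (cases "E t b")
      case True
      then show ?thesis
        using assms(1,2) 4 add_triangle_parallel[of t b] add_triangle_free_corner[of t b]
        unfolding drawable_def by auto
    next
      case False
      then have "parallel_form E W t b" using assms(1) by (simp add: drawable_def)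
      from add_across_parallel[OF this False 4 assms(2)] show ?thesis using 4 by (simp add: drawable_def)
    qed
  qed
qed

end

text \<open>The unprocessed vertices are \<open>U\<close>, and \<open>None\<close> is a dummy vertex without neighbours.\<close>

inductive layout :: "('a \<Rightarrow> 'a \<Rightarrow> bool) \<Rightarrow> 'a set \<Rightarrow> 'a option \<Rightarrow> 'a option \<Rightarrow> bool"
  for E where
  layout_empty: "layout E {} t b"
| layout_left: "\<lbrakk>v \<in> U; \<And>x u. t = Some x \<Longrightarrow> u \<in> U \<Longrightarrow> E x u \<Longrightarrow> u = v;
    layout E (U - {v}) (Some v) b\<rbrakk> \<Longrightarrow> layout E U t b"
| layout_right: "\<lbrakk>v \<in> U; \<And>x u. b = Some x \<Longrightarrow> u \<in> U \<Longrightarrow> E x u \<Longrightarrow> u = v;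
    layout E (U - {v}) t (Some v)\<rbrakk> \<Longrightarrow> layout E U t b"

section \<open>From layouts to segment drawings\<close>

definition lift_adj :: "('a \<Rightarrow> 'a \<Rightarrow> bool) \<Rightarrow> 'a option \<Rightarrow> 'a option \<Rightarrow> bool" where
  "lift_adj E x y \<longleftrightarrow> (\<exists>u v. x = Some u \<and> y = Some v \<and> E u v)"

lemma symp_lift_adj: "symp E \<Longrightarrow> symp (lift_adj E)"
  by (auto simp: lift_adj_def symp_def)

lemma box_rep_if_drawable: "drawable E W t b \<Longrightarrow> \<exists>l r d u. box_rep E W l r d u"
  by (cases "E t b") (simp_all add: drawable_def parallel_form_def free_corner_form_def, blast+)

text \<open>The last hypothesis is the invariant of the sweep: among the drawn vertices only
  \<open>t\<close> and \<open>b\<close> see \<open>U\<close>. The side condition of a layout rule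
  says that the replaced vertex sees nothing of \<open>U\<close> but \<open>v\<close>, so the
  invariant survives.\<close>

lemma box_rep_if_layout:
  assumes "layout E U t b" "symp E" "finite W" "W \<inter> Some ` U = {}" "t \<in> W" "b \<in> W"
    and "drawable (lift_adj E) W t b"
    and "\<And>u w. u \<in> U \<Longrightarrow> w \<in> W \<Longrightarrow> lift_adj E (Some u) w \<Longrightarrow> w = t \<or> w = b"
  shows "\<exists>l r d u. box_rep (lift_adj E) (W \<union> Some ` U) l r d u"
  using assms
proof (induction arbitrary: W rule: layout.induct)
  case (layout_empty t b)
  then show ?case using box_rep_if_drawable[of "lift_adj E" W t b] by simp
next
  case (layout_left v U t b)
  have dr: "drawable (lift_adj E) (insert (Some v) W) (Some v) b"
    by (rule drawable_insert[OF symp_lift_adj])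
       (use layout_left.prems layout_left.hyps(1) in \<open>blast\<close>)+
  have "\<exists>l r d u. box_rep (lift_adj E) (insert (Some v) W \<union> Some ` (U - {v})) l r d u"
  proof (rule layout_left.IH[OF _ _ _ _ _ dr])
    fix u w assume u: "u \<in> U - {v}" and w: "w \<in> insert (Some v) W" and a: "lift_adj E (Some u) w"
    show "w = Some v \<or> w = b"
    proof (rule ccontr)
      assume n: "\<not> (w = Some v \<or> w = b)"
      then have "w \<in> W" "w = t" using w layout_left.prems(7)[OF _ _ a] u by auto
      then obtain x where "t = Some x" "E u x" using a by (auto simp: lift_adj_def)
      then show False using layout_left.hyps(2)[of x u] u sympD[OF layout_left.prems(1)] by auto
    qed
  qed (use layout_left.prems layout_left.hyps(1) in auto)
  moreover have "insert (Some v) W \<union> Some ` (U - {v}) = W \<union> Some ` U" using layout_left.hyps(1) by auto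
  ultimately show ?case by simp
next
  case (layout_right v U b t)
  note com = drawable_commute[OF symp_lift_adj[OF layout_right.prems(1)]]
  have dr: "drawable (lift_adj E) (insert (Some v) W) (Some v) t"
    by (rule drawable_insert[OF symp_lift_adj _ _ com[OF layout_right.prems(6)]])
       (use layout_right.prems layout_right.hyps(1) in \<open>blast\<close>)+
  have "\<exists>l r d u. box_rep (lift_adj E) (insert (Some v) W \<union> Some ` (U - {v})) l r d u"
  proof (rule layout_right.IH[OF _ _ _ _ _ com[OF dr]])
    fix u w assume u: "u \<in> U - {v}" and w: "w \<in> insert (Some v) W" and a: "lift_adj E (Some u) w"
    show "w = t \<or> w = Some v"
    proof (rule ccontr)
      assume n: "\<not> (w = t \<or> w = Some v)"
      then have "w \<in> W" "w = b" using w layout_right.prems(7)[OF _ _ a] u by auto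
      then obtain x where "b = Some x" "E u x" using a by (auto simp: lift_adj_def)
      then show False using layout_right.hyps(2)[of x u] u sympD[OF layout_right.prems(1)] by auto
    qed
  qed (use layout_right.prems layout_right.hyps(1) in auto)
  moreover have "insert (Some v) W \<union> Some ` (U - {v}) = W \<union> Some ` U" using layout_right.hyps(1) by auto
  ultimately show ?case by simp
qed

lemma axis_parallel_closed_segment:
  assumes "l \<le> r" "d \<le> u" "l = r \<or> d = u"
  shows "closed_segment (Complex l d) (Complex r u) = {z. l \<le> Re z \<and> Re z \<le> r \<and> d \<le> Im z \<and> Im z \<le> u}"
  using assms by (auto simp: closed_segment_same_Re closed_segment_same_Im closed_segment_eq_real_ivl)

lemma B0_VPG_if_box_rep:
  assumes "box_rep E (f ` pverts G) l r d u" "inj_on f (pverts G)"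
    and "\<And>x y. x \<in> pverts G \<Longrightarrow> y \<in> pverts G \<Longrightarrow> E (f x) (f y) \<longleftrightarrow> (x, y) \<in> parcs G"
  shows "B0_VPG G"
proof -
  define S where "S x = closed_segment (Complex (l (f x)) (d (f x))) (Complex (r (f x)) (u (f x)))" for x
  have S: "S x = {z. l (f x) \<le> Re z \<and> Re z \<le> r (f x) \<and> d (f x) \<le> Im z \<and> Im z \<le> u (f x)}"
    if "x \<in> pverts G" for x
    unfolding S_def using box_repD[OF assms(1), of "f x"] that by (intro axis_parallel_closed_segment) auto
  have 1: "horizontal_segment (S x) \<or> vertical_segment (S x)" if "x \<in> pverts G" for x
  proof -
    let ?p = "Complex (l (f x)) (d (f x))" and ?q = "Complex (r (f x)) (u (f x))"
    have "Re ?p = Re ?q \<or> Im ?p = Im ?q" using box_repD(3)[OF assms(1), of "f x"] that by auto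
    then show ?thesis unfolding horizontal_segment_def vertical_segment_def S_def by blast
  qed
  have 2: "(x, y) \<in> parcs G \<longleftrightarrow> S x \<inter> S y \<noteq> {}" if xy: "x \<in> pverts G" "y \<in> pverts G" "x \<noteq> y" for x y
  proof -
    let ?I = "l (f x) \<le> r (f y) \<and> l (f y) \<le> r (f x) \<and> d (f x) \<le> u (f y) \<and> d (f y) \<le> u (f x)"
    have "(x, y) \<in> parcs G \<longleftrightarrow> ?I"
      using box_rep_adjacent_iff[OF assms(1), of "f x" "f y"] xy assms(2,3) by (auto simp: inj_on_eq_iff)
    also have "?I \<longleftrightarrow> S x \<inter> S y \<noteq> {}"
    proof
      assume ?I
      \<comment> \<open>Overlap in each coordinate suffices: the componentwise maximum of the lower
        left corners lies in both segments.\<close>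
      then have "Complex (max (l (f x)) (l (f y))) (max (d (f x)) (d (f y))) \<in> S x \<inter> S y"
        using S xy box_repD(1,2)[OF assms(1), of "f x"] box_repD(1,2)[OF assms(1), of "f y"] by auto
      then show "S x \<inter> S y \<noteq> {}" by blast
    next
      assume "S x \<inter> S y \<noteq> {}"
      then show ?I using S xy by fastforce
    qed
    finally show ?thesis .
  qed
  show ?thesis unfolding B0_VPG_def using 1 2 by blast
qed

lemma box_rep_subset: "box_rep E W l r d u \<Longrightarrow> W' \<subseteq> W \<Longrightarrow> box_rep E W' l r d u"
  by (auto simp: box_rep_def subset_iff)

lemma box_rep_if_start_layout:
  assumes "layout E (V - {s}) (Some s) None" "s \<in> V" "symp E"
  shows "\<exists>l r d u. box_rep (lift_adj E) (Some ` V) l r d u"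
proof -
  \<comment> \<open>The start vertex is the point (0, 1) and the dummy the point (0, 0): disjoint,
    with equal right ends.\<close>
  have "box_rep (lift_adj E) {Some s, None} (\<lambda>_. 0) (\<lambda>_. 0)
      (\<lambda>x. if x = None then 0 else 1) (\<lambda>x. if x = None then 0 else 1)"
    by (auto simp: box_rep_def lift_adj_def)
  then have "parallel_form (lift_adj E) {Some s, None} (Some s) None"
    unfolding parallel_form_def by force
  then have "drawable (lift_adj E) {Some s, None} (Some s) None"
    by (auto simp: drawable_def lift_adj_def)
  from box_rep_if_layout[OF assms(1,3) _ _ _ _ this] obtain l r d u where
    "box_rep (lift_adj E) ({Some s, None} \<union> Some ` (V - {s})) l r d u" by (auto simp: lift_adj_def)
  from box_rep_subset[OF this] show ?thesis using assms(2) by blast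
qed

section \<open>Connectivity inside vertex sets\<close>

text \<open>The reflexive closure relates every \<open>x\<close> to itself, so membership of
  \<open>x\<close> in \<open>A\<close> has to be demanded separately.\<close>

definition conn :: "('a \<Rightarrow> 'a \<Rightarrow> bool) \<Rightarrow> 'a set \<Rightarrow> 'a \<Rightarrow> 'a \<Rightarrow> bool" where
  "conn E A x y \<longleftrightarrow> x \<in> A \<and> (x, y) \<in> {(u, v). u \<in> A \<and> v \<in> A \<and> E u v}\<^sup>*"

definition nbhd :: "('a \<Rightarrow> 'a \<Rightarrow> bool) \<Rightarrow> 'a \<Rightarrow> 'a set" where
  "nbhd E z = insert z {x. E z x}"

definition misses :: "('a \<Rightarrow> 'a \<Rightarrow> bool) \<Rightarrow> 'a set \<Rightarrow> 'a \<Rightarrow> 'a \<Rightarrow> 'a \<Rightarrow> bool" where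
  "misses E V x y z \<longleftrightarrow> conn E (V - nbhd E z) x y"

text \<open>Distinctness and nonadjacency are implied, because \<open>misses\<close> keeps the ends
  of each path outside the closed neighbourhood of the third vertex.\<close>

definition has_AT :: "('a \<Rightarrow> 'a \<Rightarrow> bool) \<Rightarrow> 'a set \<Rightarrow> bool" where
  "has_AT E V \<longleftrightarrow> (\<exists>a\<in>V. \<exists>b\<in>V. \<exists>c\<in>V. misses E V a b c \<and> misses E V b c a \<and> misses E V a c b)"

definition admissible :: "('a \<Rightarrow> 'a \<Rightarrow> bool) \<Rightarrow> 'a set \<Rightarrow> 'a \<Rightarrow> bool" where
  "admissible E V s \<longleftrightarrow> s \<in> V \<and> \<not> (\<exists>y\<in>V. \<exists>z\<in>V. misses E V s y z \<and> misses E V s z y)"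

definition connected_set :: "('a \<Rightarrow> 'a \<Rightarrow> bool) \<Rightarrow> 'a set \<Rightarrow> bool" where
  "connected_set E X \<longleftrightarrow> X \<noteq> {} \<and> (\<forall>x\<in>X. \<forall>y\<in>X. conn E X x y)"

definition touches :: "('a \<Rightarrow> 'a \<Rightarrow> bool) \<Rightarrow> 'a set \<Rightarrow> 'a set \<Rightarrow> bool" where
  "touches E X Y \<longleftrightarrow> (\<exists>x\<in>X. \<exists>y\<in>Y. E x y)"

text \<open>The five sets are the branch sets of a K_{2,3} minor; \<open>X\<close> and
  \<open>Y\<close> form the side of size two.\<close>

definition K23_minor_free :: "('a \<Rightarrow> 'a \<Rightarrow> bool) \<Rightarrow> bool" where
  "K23_minor_free E \<longleftrightarrow> (\<forall>X Y A B C. connected_set E X \<longrightarrow> connected_set E Y \<longrightarrow>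
     connected_set E A \<longrightarrow> connected_set E B \<longrightarrow> connected_set E C \<longrightarrow>
     X \<inter> Y = {} \<longrightarrow> X \<inter> A = {} \<longrightarrow> X \<inter> B = {} \<longrightarrow> X \<inter> C = {} \<longrightarrow> Y \<inter> A = {} \<longrightarrow> Y \<inter> B = {} \<longrightarrow>
     Y \<inter> C = {} \<longrightarrow> A \<inter> B = {} \<longrightarrow> A \<inter> C = {} \<longrightarrow> B \<inter> C = {} \<longrightarrow>
     touches E X A \<longrightarrow> touches E X B \<longrightarrow> touches E X C \<longrightarrow>
     touches E Y A \<longrightarrow> touches E Y B \<longrightarrow> touches E Y C \<longrightarrow> False)"

definition K4_free :: "('a \<Rightarrow> 'a \<Rightarrow> bool) \<Rightarrow> bool" where
  "K4_free E \<longleftrightarrow> \<not> (\<exists>a b c d. E a b \<and> E a c \<and> E a d \<and> E b c \<and> E b d \<and> E c d)"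

lemma conn_refl: "x \<in> A \<Longrightarrow> conn E A x x"
  by (simp add: conn_def)

lemma conn_in:
  assumes "conn E A x y" shows "x \<in> A" "y \<in> A"
proof -
  show "x \<in> A" using assms by (simp add: conn_def)
  have "(x, y) \<in> {(u, v). u \<in> A \<and> v \<in> A \<and> E u v}\<^sup>*" using assms by (simp add: conn_def)
  then show "y \<in> A" using \<open>x \<in> A\<close> by (induction rule: rtrancl_induct) auto
qed

lemma conn_step: "conn E A x y \<Longrightarrow> E y z \<Longrightarrow> z \<in> A \<Longrightarrow> conn E A x z"
  using conn_in(2)[of E A x y] unfolding conn_def
  by (auto intro: rtrancl_into_rtrancl)

lemma conn_edge: "x \<in> A \<Longrightarrow> y \<in> A \<Longrightarrow> E x y \<Longrightarrow> conn E A x y"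
  by (rule conn_step[OF conn_refl])

lemma conn_trans: "conn E A x y \<Longrightarrow> conn E A y z \<Longrightarrow> conn E A x z"
  unfolding conn_def by auto

lemma conn_induct [consumes 1, case_names refl step]:
  assumes "conn E A x y" "x \<in> A \<Longrightarrow> P x"
    "\<And>y z. conn E A x y \<Longrightarrow> P y \<Longrightarrow> E y z \<Longrightarrow> z \<in> A \<Longrightarrow> P z"
  shows "P y"
proof -
  have "(x, y) \<in> {(u, v). u \<in> A \<and> v \<in> A \<and> E u v}\<^sup>*" and x: "x \<in> A" using assms(1) by (simp_all add: conn_def)
  then show ?thesis
  proof (induction rule: rtrancl_induct)
    case base then show ?case using assms(2) by simp
  next
    case (step y z)
    then show ?case using assms(3)[of y z] by (auto simp: conn_def)
  qed
qed

lemma conn_mono: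
  assumes "conn E A x y" "A \<subseteq> B" shows "conn E B x y"
  using assms
  by (induction rule: conn_induct) (auto intro: conn_refl conn_step)

lemma conn_sym:
  assumes "symp E" "conn E A x y" shows "conn E A y x"
  using assms(2)
proof (induction rule: conn_induct)
  case refl then show ?case by (rule conn_refl)
next
  case (step y z)
  have "conn E A z y" using step conn_in(2)[OF step(1)] sympD[OF assms(1)] by (intro conn_edge) auto
  then show ?case using step.IH conn_trans by metis
qed

lemma conn_component: "conn E A w y \<Longrightarrow> conn E {z. conn E A w z} w y"
proof (induction rule: conn_induct)
  case refl then show ?case by (auto intro!: conn_refl)
next
  case (step y z)
  then show ?case using conn_step[OF step.hyps] by (auto intro: conn_step)
qed

lemma connected_set_component:
  assumes "symp E" "w \<in> A" shows "connected_set E {z. conn E A w z}"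
  unfolding connected_set_def
proof (intro conjI ballI)
  show "{z. conn E A w z} \<noteq> {}" using assms(2) conn_refl by fast
  fix x y assume "x \<in> {z. conn E A w z}" "y \<in> {z. conn E A w z}"
  then have "conn E {z. conn E A w z} w x" "conn E {z. conn E A w z} w y"
    by (auto intro: conn_component)
  then show "conn E {z. conn E A w z} x y" using assms(1) by (meson conn_sym conn_trans)
qed

text \<open>Cut a walk at its first visit to \<open>t\<close>.\<close>

lemma conn_last_step:
  assumes "conn E A s t" "s \<noteq> t" shows "\<exists>y. conn E (A - {t}) s y \<and> E y t"
proof -
  have "conn E (A - {t}) s x \<or> (\<exists>y. conn E (A - {t}) s y \<and> E y t)" if "conn E A s x" for x
    using that
  proof (induction rule: conn_induct)
    case refl then show ?case using assms(2) by (auto intro: conn_refl)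
  next
    case (step y z)
    then show ?case using conn_step[of E "A - {t}" s y z] by (cases "z = t") auto
  qed
  from this[OF assms(1)] show ?thesis using conn_in(2)[of E "A - {t}" s t] by auto
qed

lemma connected_set_singleton: "connected_set E {x}"
  by (simp add: connected_set_def conn_refl)

lemma connected_set_insert:
  assumes "symp E" "connected_set E X" "y \<in> X" "E x y" shows "connected_set E (insert x X)"
proof -
  have 1: "conn E (insert x X) a b" if "a \<in> X" "b \<in> X" for a b
    using assms(2) that by (auto simp: connected_set_def intro: conn_mono)
  have 2: "conn E (insert x X) x a" if "a \<in> X" for a
    using conn_trans[OF conn_edge[of x "insert x X" y E]] 1 that assms by auto
  then show ?thesis
    using 1 2 conn_sym[OF assms(1) 2] by (auto simp: connected_set_def intro: conn_refl)
qed

lemma connected_set_pair: "symp E \<Longrightarrow> E x y \<Longrightarrow> connected_set E {x, y}"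
  using connected_set_insert[OF _ connected_set_singleton] by fast

lemma connected_set_successively:
  assumes "symp E" "successively E xs" "xs \<noteq> []" shows "connected_set E (set xs)"
  using assms(2,3)
proof (induction xs)
  case (Cons x xs)
  show ?case
  proof (cases xs)
    case Nil then show ?thesis by (simp add: connected_set_singleton)
  next
    case (Cons y ys)
    then show ?thesis using Cons.IH Cons.prems connected_set_insert[OF assms(1), of "set xs" y x] by auto
  qed
qed simp

lemma touches_singleton [simp]: "touches E {x} Y \<longleftrightarrow> (\<exists>y\<in>Y. E x y)"
  "touches E X {y} \<longleftrightarrow> (\<exists>x\<in>X. E x y)"
  by (auto simp: touches_def)

lemma misses_in:
  assumes "misses E V x y z"
  shows "x \<in> V" "y \<in> V" "x \<notin> nbhd E z" "y \<notin> nbhd E z"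
  using conn_in[of E "V - nbhd E z" x y] assms by (auto simp: misses_def)

lemma misses_mono: "misses E V x y z \<Longrightarrow> V \<subseteq> V' \<Longrightarrow> misses E V' x y z"
  unfolding misses_def by (erule conn_mono) auto

lemma has_AT_mono: "has_AT E V \<Longrightarrow> V \<subseteq> V' \<Longrightarrow> has_AT E V'"
  unfolding has_AT_def by (meson misses_mono subsetD)

lemma has_ATI:
  assumes "misses E V a b c" "misses E V b c a" "misses E V a c b" shows "has_AT E V"
  using assms misses_in unfolding has_AT_def by metis


section \<open>Admissible vertices\<close>

text \<open>Choose \<open>x\<close> and a component \<open>K\<close> of the graph without the closed neighbourhood of \<open>x\<close> such that \<open>K\<close>
  is as large as possible. By maximality every vertex that is neither in \<open>K\<close> nor adjacent to it is
  adjacent to all neighbours of \<open>K\<close>, so a vertex admissible in that remainder is admissible in \<open>V\<close>.\<close>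

lemma ex_admissible:
  assumes "symp E" "finite V" "V \<noteq> {}" "\<not> has_AT E V"
  shows "\<exists>s. admissible E V s"
  using assms(2-4)
proof (induction "card V" arbitrary: V rule: less_induct)
  case less
  show ?case
  proof (cases "\<forall>x\<in>V. V \<subseteq> nbhd E x")
    case True
    obtain s where "s \<in> V" using less.prems by blast
    then have "admissible E V s" using True misses_in(3)[of E V s] unfolding admissible_def by blast
    then show ?thesis ..
  next
    case False
    let ?P = "{(x, w). x \<in> V \<and> w \<in> V - nbhd E x}"
    let ?c = "\<lambda>x w. {y. conn E (V - nbhd E x) w y}"
    have fin: "finite (?c x w)" for x w
      by (rule finite_subset[OF _ less.prems(1)]) (auto dest: conn_in)
    have "finite ?P" by (rule finite_subset[of _ "V \<times> V"]) (use less.prems(1) in auto)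
    moreover have "?P \<noteq> {}" using False by auto
    ultimately have "\<exists>p\<in>?P. \<forall>p'\<in>?P. card (?c (fst p') (snd p')) \<le> card (?c (fst p) (snd p))"
      using finite_has_maximal[of "(\<lambda>p. card (?c (fst p) (snd p))) ` ?P"]
      by (smt (verit) finite_imageI image_iff image_is_empty linorder_le_cases)
    then obtain x w where xw: "x \<in> V" "w \<in> V" "w \<notin> nbhd E x"
      and max: "\<And>x' w'. x' \<in> V \<Longrightarrow> w' \<in> V - nbhd E x' \<Longrightarrow> card (?c x' w') \<le> card (?c x w)"
      by auto
    define K where "K = ?c x w"
    define NK where "NK = {v \<in> V - K. \<exists>k\<in>K. E k v}"
    define A where "A = V - K - NK"
    have KV: "K \<subseteq> V - nbhd E x" unfolding K_def by (auto dest: conn_in)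
    have wK: "w \<in> K" unfolding K_def using xw by (auto intro: conn_refl)
    have conK: "connected_set E K" unfolding K_def
      by (rule connected_set_component[OF assms(1)]) (use xw in auto)
    have xA: "x \<in> A"
      using KV xw sympD[OF assms(1)] unfolding A_def NK_def nbhd_def by blast
    have AK: "\<not> E a k" "\<not> E k a" if "a \<in> A" "k \<in> K" for a k
      using that sympD[OF assms(1)] unfolding A_def NK_def by blast+
    have complete: "NK \<subseteq> nbhd E a" if a: "a \<in> A" for a
    proof
      fix n assume n: "n \<in> NK"
      show "n \<in> nbhd E a"
      proof (rule ccontr)
        assume na: "n \<notin> nbhd E a"
        \<comment> \<open>Otherwise \<open>K\<close> together with \<open>n\<close> would lie in one
          component outside the closed neighbourhood of \<open>a\<close>, which would be larger than
          \<open>K\<close>.\<close>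
        have sub: "K \<subseteq> V - nbhd E a" using KV AK a unfolding nbhd_def A_def by blast
        have "K \<subseteq> ?c a w"
          using conK wK sub by (auto simp: connected_set_def intro: conn_mono)
        moreover have "n \<in> ?c a w"
        proof -
          obtain k where "k \<in> K" "E k n" using n unfolding NK_def by auto
          moreover have "conn E (V - nbhd E a) w k" using \<open>K \<subseteq> ?c a w\<close> \<open>k \<in> K\<close> by auto
          ultimately show ?thesis using n na unfolding NK_def by (auto intro: conn_step)
        qed
        moreover have "n \<notin> K" using n unfolding NK_def by auto
        ultimately have "card K < card (?c a w)" by (intro psubset_card_mono[OF fin]) auto
        then show False using max[of a w] a sub wK unfolding K_def[symmetric] A_def by auto
      qed
    qed
    have "A \<subset> V" using xw wK unfolding A_def by auto
    then have cA: "card A < card V" using less.prems(1) by (simp add: psubset_card_mono)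
    have "\<not> has_AT E A" using less.prems(3) \<open>A \<subset> V\<close> by (meson has_AT_mono psubsetE)
    moreover have "finite A" using \<open>A \<subset> V\<close> less.prems(1) by (meson finite_subset psubsetE)
    ultimately obtain s where s: "admissible E A s" using less.hyps[OF cA] xA by blast
    then have sA: "s \<in> A" by (simp add: admissible_def)
    \<comment> \<open>A path can leave \<open>A\<close> only through \<open>NK\<close>, and all of
      \<open>NK\<close> lies in the closed neighbourhood of \<open>z\<close>.\<close>
    have stay: "misses E A s y z" if "z \<in> A" "misses E V s y z" for y z
      using that(2) unfolding misses_def
    proof (induction rule: conn_induct)
      case refl then show ?case using sA by (auto intro: conn_refl)
    next
      case (step u v)
      have "u \<in> A" using conn_in[OF step.IH] by auto
      then have "v \<in> A" using step complete[OF that(1)] AK unfolding A_def by blast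
      then show ?case using step by (auto intro: conn_step)
    qed
    have "\<not> (misses E V s y z \<and> misses E V s z y)" for y z
    proof
      assume m: "misses E V s y z \<and> misses E V s z y"
      have notA: "\<not> (z \<in> A \<or> y \<in> A)"
      proof
        assume "z \<in> A \<or> y \<in> A"
        then have "z \<in> A \<and> y \<in> A" using m stay misses_in(2) by metis
        then show False using m stay s unfolding admissible_def by blast
      qed
      have "y \<notin> NK" "z \<notin> NK"
        using m misses_in(3)[of E V s] complete[OF sA] sympD[OF assms(1)] unfolding nbhd_def by blast+
      then have yz: "y \<in> K" "z \<in> K" using notA m misses_in(2)[of E V s] unfolding A_def by blast+
      \<comment> \<open>Now \<open>K\<close> itself links \<open>y\<close> and \<open>z\<close> away
        from \<open>s\<close>, which completes an asteroidal triple.\<close>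
      have "K \<subseteq> V - nbhd E s" using KV AK sA unfolding nbhd_def A_def by blast
      then have "misses E V y z s" unfolding misses_def
        using conK yz by (auto simp: connected_set_def intro: conn_mono)
      then show False using m less.prems(3) has_ATI by metis
    qed
    then have "admissible E V s" using sA unfolding admissible_def A_def by auto
    then show ?thesis ..
  qed
qed


section \<open>Existence of layouts\<close>

lemma layout_commute:
  assumes "layout E U t b" shows "layout E U b t"
  using assms
proof (induction rule: layout.induct)
  case layout_empty then show ?case by (rule layout.layout_empty)
next
  case (layout_left v U t b) show ?case
    by (rule layout.layout_right[OF layout_left.hyps(1)]) (use layout_left in auto)
next
  case (layout_right v U b t) show ?case
    by (rule layout.layout_left[OF layout_right.hyps(1)]) (use layout_right in auto)
qed

lemma K23_minor_freeD:
  assumes "K23_minor_free E" "connected_set E X" "connected_set E Y"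
    "connected_set E A" "connected_set E B" "connected_set E C"
    "X \<inter> Y = {}" "X \<inter> A = {}" "X \<inter> B = {}" "X \<inter> C = {}" "Y \<inter> A = {}" "Y \<inter> B = {}"
    "Y \<inter> C = {}" "A \<inter> B = {}" "A \<inter> C = {}" "B \<inter> C = {}"
    "touches E X A" "touches E X B" "touches E X C" "touches E Y A" "touches E Y B" "touches E Y C"
  shows False
  using assms unfolding K23_minor_free_def by metis

text \<open>In such an order each vertex can replace its predecessor in a sweep. Consecutive
  vertices may be nonadjacent, so a whole linear forest can be listed.\<close>

fun forward_path :: "('a \<Rightarrow> 'a \<Rightarrow> bool) \<Rightarrow> 'a list \<Rightarrow> bool" where
  "forward_path E [] = True"
| "forward_path E (r # rs) = ((\<forall>u\<in>set rs. E r u \<longrightarrow> u = hd rs) \<and> forward_path E rs)"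

lemma forward_path_snoc:
  assumes "forward_path E rs" "\<And>u. u \<in> set (butlast rs) \<Longrightarrow> \<not> E u p"
  shows "forward_path E (rs @ [p])"
  using assms
proof (induction rs)
  case (Cons r rs) then show ?case by (cases rs) auto
qed simp

text \<open>The list passes through the slot of \<open>t\<close> while \<open>b\<close> stays put.
  The set \<open>S\<close> confines the unprocessed neighbours of all vertices before the last one
  to the list, so none of them is left behind unfinished.\<close>

lemma layout_forward_path:
  assumes "forward_path E rs" "rs \<noteq> []" "distinct rs" "set rs \<subseteq> U"
    and "\<And>x u. t = Some x \<Longrightarrow> u \<in> U \<Longrightarrow> E x u \<Longrightarrow> u = hd rs"
    and "\<And>r u. r \<in> set (butlast rs) \<Longrightarrow> u \<in> U \<Longrightarrow> E r u \<Longrightarrow> u \<in> S"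
    and "S \<inter> U \<subseteq> set rs" "\<And>x. \<not> E x x"
    and "layout E (U - set rs) (Some (last rs)) b"
  shows "layout E U t b"
  using assms
proof (induction rs arbitrary: U t)
  case (Cons r rs)
  show ?case
  proof (rule layout_left)
    show "r \<in> U" using Cons.prems by simp
    show "u = r" if "t = Some x" "u \<in> U" "E x u" for x u using Cons.prems(5)[OF that] by simp
    show "layout E (U - {r}) (Some r) b"
    proof (cases "rs = []")
      case True then show ?thesis using Cons.prems(9) by simp
    next
      case False
      show ?thesis
      proof (rule Cons.IH[OF _ False])
        show "u = hd rs" if "Some r = Some x" "u \<in> U - {r}" "E x u" for x u
        proof -
          have "u \<in> S" using Cons.prems(6)[of r u] that False by auto
          then have "u \<in> set rs" using Cons.prems(7) that by auto
          then show ?thesis using Cons.prems(1) that by auto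
        qed
        show "u \<in> S" if "r' \<in> set (butlast rs)" "u \<in> U - {r}" "E r' u" for r' u
          using Cons.prems(6)[of r' u] that False by auto
        show "layout E (U - {r} - set rs) (Some (last rs)) b"
        proof -
          have "U - {r} - set rs = U - set (r # rs)" by auto
          then show ?thesis using Cons.prems(9) False by simp
        qed
        show "forward_path E rs" "distinct rs" "set rs \<subseteq> U - {r}" "S \<inter> (U - {r}) \<subseteq> set rs"
          using Cons.prems(1,3,4,7) by auto
        show "\<not> E x x" for x by (rule Cons.prems(8))
      qed
    qed
  qed
qed simp

locale K23_K4_free =
  fixes E :: "'a \<Rightarrow> 'a \<Rightarrow> bool"
  assumes symE: "symp E" and irrefl: "\<not> E x x"
    and K23: "K23_minor_free E" and K4: "K4_free E"
begin

lemma sym: "E x y \<Longrightarrow> E y x"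
  using symE by (rule sympD)

lemmas con_intros = connected_set_singleton connected_set_pair[OF symE]
  connected_set_insert[OF symE]

lemma no_K23: "\<lbrakk>connected_set E X; connected_set E Y; connected_set E A; connected_set E B; connected_set E C;
    X \<inter> Y = {}; X \<inter> A = {}; X \<inter> B = {}; X \<inter> C = {}; Y \<inter> A = {}; Y \<inter> B = {};
    Y \<inter> C = {}; A \<inter> B = {}; A \<inter> C = {}; B \<inter> C = {};
    touches E X A; touches E X B; touches E X C; touches E Y A; touches E Y B; touches E Y C\<rbrakk> \<Longrightarrow> False"
  by (rule K23_minor_freeD[OF K23])

lemma no_K4: "\<not> (E a b \<and> E a c \<and> E a d \<and> E b c \<and> E b d \<and> E c d)"
  using K4 unfolding K4_free_def by blast

text \<open>The set \<open>S\<close> is a third connection between \<open>t\<close> and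
  \<open>b\<close>. If every private neighbour of \<open>t\<close> is adjacent to every private
  neighbour of \<open>b\<close>, there is a K_{2,3} minor. With a common neighbour its hubs are
  \<open>t\<close> and \<open>b\<close>, joined through \<open>S\<close>, the common neighbour, and
  either a second one or an edge of private neighbours. Without one, the hubs are \<open>x1\<close>
  and \<open>x2\<close>, joined through \<open>y1\<close>, \<open>y2\<close> and
  \<open>t\<close>.\<close>

lemma not_stuck:
  assumes "t \<noteq> b" "connected_set E S" "t \<notin> S" "b \<notin> S" "S \<inter> U = {}" "touches E {t} S" "touches E {b} S"
    "t \<notin> U" "b \<notin> U"
    and x: "x1 \<in> U" "x2 \<in> U" "x1 \<noteq> x2" "E t x1" "E t x2"
    and y: "y1 \<in> U" "y2 \<in> U" "y1 \<noteq> y2" "E b y1" "E b y2"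
  shows "\<exists>x\<in>U. \<exists>y\<in>U. E t x \<and> \<not> E b x \<and> E b y \<and> \<not> E t y \<and> \<not> E x y \<and> x \<noteq> y"
proof (rule ccontr)
  assume neg: "\<not> ?thesis"
  have adj: "E x y" if "x \<in> U" "y \<in> U" "E t x" "\<not> E b x" "E b y" "\<not> E t y" for x y
    using neg that by blast
  have common: "c = c'" if "c \<in> U" "c' \<in> U" "E t c" "E b c" "E t c'" "E b c'" for c c'
  proof (rule ccontr)
    assume "c \<noteq> c'"
    then show False
      using that assms
      by (intro no_K23[of "{t}" "{b}" "{c}" "{c'}" S]) (auto intro: con_intros)
  qed
  show False
  proof (cases "\<exists>c\<in>U. E t c \<and> E b c")
    case True
    then obtain c where c: "c \<in> U" "E t c" "E b c" by blast
    obtain x where x': "x \<in> U" "E t x" "x \<noteq> c" using x by metis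
    obtain y where y': "y \<in> U" "E b y" "y \<noteq> c" using y by metis
    have nx: "\<not> E b x" "\<not> E t y" using common c x' y' by blast+
    then have "E x y" using adj x' y' by blast
    then show False
      using c x' y' nx assms(1-9)
      by (intro no_K23[of "{t}" "{b}" "{c}" "{x, y}" S]) (auto intro: con_intros)
  next
    case False
    then have "E x1 y1" "E x1 y2" "E x2 y1" "E x2 y2" using adj x y by blast+
    moreover have "x1 \<noteq> y1" "x1 \<noteq> y2" "x2 \<noteq> y1" "x2 \<noteq> y2" using False x y by auto
    moreover have "t \<noteq> x1" "t \<noteq> x2" "t \<noteq> y1" "t \<noteq> y2" using assms(8) x y by auto
    ultimately show False
      using x y sym[OF x(4)] sym[OF x(5)]
      by (intro no_K23[of "{x1}" "{x2}" "{y1}" "{y2}" "{t}"]) (auto intro: con_intros)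
  qed
qed

end

text \<open>Here \<open>b\<close> is the only processed vertex with unprocessed neighbours. The sweep has to consume all
  neighbours \<open>F\<close> of \<open>b\<close> but two, \<open>p\<close> and \<open>q\<close>, before it can leave \<open>b\<close>; \<open>F\<close> induces a linear forest.\<close>

locale fan = K23_K4_free +
  fixes U :: "'a set" and b :: 'a and F C Fd :: "'a set"
  assumes finU: "finite U" and bU: "b \<notin> U"
    and F_def: "F = {f \<in> U. E b f}" and C_def: "C = U - F" and Fd_def: "Fd = {f \<in> F. \<exists>z\<in>C. E f z}"
    and adm: "admissible E (insert b U) b" and noAT: "\<not> has_AT E (insert b U)"
begin

lemma F_facts: "f \<in> F \<Longrightarrow> f \<in> U" "f \<in> F \<Longrightarrow> E b f" "f \<in> F \<Longrightarrow> E f b" "f \<in> F \<Longrightarrow> f \<noteq> b" "f \<in> F \<Longrightarrow> f \<notin> C"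
  "finite F"
  using F_def C_def bU sym finU by auto

lemma C_facts: "z \<in> C \<Longrightarrow> z \<in> U" "z \<in> C \<Longrightarrow> \<not> E b z" "z \<in> C \<Longrightarrow> \<not> E z b" "z \<in> C \<Longrightarrow> z \<noteq> b" "z \<in> C \<Longrightarrow> z \<notin> F"
  using F_def C_def bU sym by auto

text \<open>Together with \<open>b\<close>, a vertex of \<open>F\<close> with three neighbours in
  \<open>F\<close> would be a hub of K_{2,3}.\<close>

lemma degree_le_2:
  assumes "f \<in> F" "u \<in> F" "v \<in> F" "w \<in> F" "E f u" "E f v" "E f w" "u \<noteq> v" "u \<noteq> w" "v \<noteq> w"
  shows False
  using assms F_facts irrefl
  by (intro no_K23[of "{b}" "{f}" "{u}" "{v}" "{w}"]) (auto intro: con_intros)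

text \<open>A cycle in \<open>F\<close> with \<open>b\<close> as hub is a wheel, which contains K_4
  if the cycle is a triangle and a K_{2,3} minor otherwise. So the first vertex of a longest path in
  \<open>X\<close> has no neighbour in \<open>X\<close> except its successor.\<close>

lemma ex_end:
  assumes "X \<subseteq> F" "X \<noteq> {}"
  shows "\<exists>x\<in>X. \<forall>u\<in>X. \<forall>v\<in>X. E x u \<longrightarrow> E x v \<longrightarrow> u = v"
proof -
  have finX: "finite X" using assms(1) F_facts(6) finite_subset by blast
  let ?P = "\<lambda>xs. distinct xs \<and> set xs \<subseteq> X \<and> successively E xs \<and> xs \<noteq> []"
  obtain x0 where "x0 \<in> X" using assms(2) by blast
  then have "?P [x0]" by simp
  moreover have "\<forall>xs. ?P xs \<longrightarrow> length xs < Suc (card X)"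
    using finX by (metis card_mono distinct_card le_imp_less_Suc)
  ultimately obtain xs where xs: "?P xs" and max: "\<And>ys. ?P ys \<Longrightarrow> length ys \<le> length xs"
    using ex_has_greatest_nat[of ?P "[x0]" length "Suc (card X)"] by (metis (no_types, lifting))
  then obtain x ys where x: "xs = x # ys" by (cases xs) auto
  have inn: "u \<in> set ys" if "u \<in> X" "E x u" for u
  proof (rule ccontr)
    assume "u \<notin> set ys"
    then have "?P (u # xs)" using xs x that sym irrefl by auto
    then show False using max by fastforce
  qed
  have "u = hd ys" if u: "u \<in> X" "E x u" for u
  proof (rule ccontr)
    assume ne: "u \<noteq> hd ys"
    obtain y zs where y: "ys = y # zs" using inn[OF u] by (cases ys) auto
    then have "u \<in> set zs" using inn[OF u] ne by auto
    then obtain as bs where zs: "zs = as @ u # bs" by (meson split_list)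
    have F: "x \<in> F" "y \<in> F" "u \<in> F" "set as \<subseteq> F" using xs x y zs assms(1) by auto
    have d: "distinct (x # y # as @ [u])" using xs x y zs by auto
    have xy: "E x y" using xs x y by auto
    show False
    proof (cases "as = []")
      case True
      then have "E y u" using xs x y zs by auto
      then show False using no_K4[of b x y u] F F_facts xy u by auto
    next
      case False
      have suc: "successively E as" using xs x y zs by (auto simp: successively_append_iff successively_Cons)
      have 1: "E y (hd as)" using xs x y zs False by (cases as) (auto simp: successively_append_iff)
      have 2: "E (last as) u" using xs x y zs False by (auto simp: successively_append_iff successively_Cons)
      have "connected_set E (set as)" by (rule connected_set_successively[OF symE suc False])
      moreover have "hd as \<in> set as" "last as \<in> set as" using False by auto
      moreover have "x \<noteq> b" "y \<noteq> b" "u \<noteq> b" "b \<notin> set as" using F F_facts(4) by auto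
      ultimately show False
        using d xy u F_facts(2,3) F 1 2
        by (intro no_K23[of "{x}" "set as" "{y}" "{u}" "{b}"]) (auto intro: con_intros sym)
    qed
  qed
  then show ?thesis using xs x by (intro bexI[of _ x]) auto
qed

text \<open>The list is built backwards from \<open>p\<close>. Before \<open>p\<close> comes its
  neighbour in \<open>R\<close>, which by \<open>degree_le_2\<close> keeps at most one other
  neighbour, or any end of the rest if \<open>p\<close> is isolated in \<open>R\<close>.\<close>

lemma ex_forward_path:
  assumes "R \<subseteq> F" "p \<in> R" "\<And>u v. u \<in> R \<Longrightarrow> v \<in> R \<Longrightarrow> E p u \<Longrightarrow> E p v \<Longrightarrow> u = v"
  shows "\<exists>rs. forward_path E rs \<and> distinct rs \<and> set rs = R \<and> rs \<noteq> [] \<and> last rs = p"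
  using assms
proof (induction "card R" arbitrary: R p rule: less_induct)
  case less
  have finR: "finite R" using less.prems(1) F_facts(6) finite_subset by blast
  show ?case
  proof (cases "R = {p}")
    case True then show ?thesis by (intro exI[of _ "[p]"]) auto
  next
    case False
    have "\<exists>p'\<in>R - {p}. (\<forall>u\<in>R - {p}. \<forall>v\<in>R - {p}. E p' u \<longrightarrow> E p' v \<longrightarrow> u = v) \<and>
        (\<forall>u\<in>R. E p u \<longrightarrow> u = p')"
    proof (cases "\<exists>p'\<in>R. E p p'")
      case True
      then obtain p' where p': "p' \<in> R" "E p p'" by blast
      have "u = v" if "u \<in> R - {p}" "v \<in> R - {p}" "E p' u" "E p' v" for u v
        using degree_le_2[of p' u v p] that p' less.prems(1,2) sym by blast
      then show ?thesis using p' less.prems(3) irrefl by (intro bexI[of _ p']) blast+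
    next
      case no: False
      have "R - {p} \<noteq> {}" using False less.prems(2) by auto
      then show ?thesis using ex_end[of "R - {p}"] less.prems(1) no by blast
    qed
    then obtain p' where p': "p' \<in> R - {p}" "\<forall>u\<in>R - {p}. \<forall>v\<in>R - {p}. E p' u \<longrightarrow> E p' v \<longrightarrow> u = v"
      "\<forall>u\<in>R. E p u \<longrightarrow> u = p'" by blast
    have "card (R - {p}) < card R" using finR less.prems(2) by (meson card_Diff1_less)
    from less.hyps[OF this _ p'(1)] obtain rs where rs: "forward_path E rs" "distinct rs"
      "set rs = R - {p}" "rs \<noteq> []" "last rs = p'"
      using p'(2) less.prems(1) by blast
    have "\<not> E u p" if "u \<in> set (butlast rs)" for u
    proof
      assume "E u p"
      moreover have "u \<in> R" using in_set_butlastD[OF that] rs(3) by auto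
      ultimately have "u = p'" using sym p'(3) by blast
      moreover have "rs = butlast rs @ [p']" using rs(4,5) by (metis append_butlast_last_id)
      ultimately show False using rs(2) that by (metis distinct_append disjoint_insert(1) list.set(2))
    qed
    then have "forward_path E (rs @ [p])" by (rule forward_path_snoc[OF rs(1)])
    then show ?thesis using rs less.prems(2) by (intro exI[of _ "rs @ [p]"]) auto
  qed
qed

lemma misses_path3:
  assumes "x \<in> insert b U - nbhd E w" "y \<in> insert b U - nbhd E w" "z \<in> insert b U - nbhd E w" "E x y" "E y z"
  shows "misses E (insert b U) x z w"
  unfolding misses_def using assms by (blast intro: conn_step conn_refl)

text \<open>Otherwise the paths \<open>b\<close>, \<open>f\<close>, \<open>z\<close> and
  \<open>b\<close>, \<open>f'\<close>, \<open>z'\<close> avoid the closed neighbourhoods of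
  \<open>z'\<close> and \<open>z\<close>, against admissibility of \<open>b\<close>.\<close>

lemma deep_pair:
  assumes "f \<in> F" "f' \<in> F" "z \<in> C" "z' \<in> C" "E f z" "E f' z'" "\<not> conn E C z z'"
  shows "E f z' \<or> E f' z"
proof (rule ccontr)
  assume n: "\<not> (E f z' \<or> E f' z)"
  have zz: "\<not> E z z'" "z \<noteq> z'" using assms conn_edge[of z C z' E] conn_refl[of z C E] by auto
  have "misses E (insert b U) b z z'"
    by (rule misses_path3[of _ _ f]) (use assms n zz F_facts C_facts sym in \<open>auto simp: nbhd_def\<close>)
  moreover have "misses E (insert b U) b z' z"
    by (rule misses_path3[of _ _ f']) (use assms n zz F_facts C_facts sym in \<open>auto simp: nbhd_def\<close>)
  ultimately show False using adm assms C_facts unfolding admissible_def by blast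
qed

text \<open>Contracting \<open>Q\<close> gives a second hub, besides \<open>b\<close>, for
  \<open>d1\<close>, \<open>d2\<close>, \<open>d3\<close>.\<close>

lemma attach_le_2:
  assumes "connected_set E Q" "Q \<subseteq> C" "d1 \<in> F" "d2 \<in> F" "d3 \<in> F" "d1 \<noteq> d2" "d1 \<noteq> d3" "d2 \<noteq> d3"
    "q1 \<in> Q" "q2 \<in> Q" "q3 \<in> Q" "E d1 q1" "E d2 q2" "E d3 q3"
  shows False
proof -
  have "b \<notin> Q" "d1 \<notin> Q" "d2 \<notin> Q" "d3 \<notin> Q" using assms F_facts C_facts by blast+
  then show False using assms F_facts
    by (intro no_K23[of "{b}" Q "{d1}" "{d2}" "{d3}"]) (auto intro: con_intros sym)
qed

lemma component_C: "z \<in> C \<Longrightarrow> connected_set E {y. conn E C z y}" "{y. conn E C z y} \<subseteq> C"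
  "z \<in> C \<Longrightarrow> z \<in> {y. conn E C z y}"
  using connected_set_component[OF symE] conn_in conn_refl by fast+

text \<open>The component of \<open>z1\<close> and \<open>z2\<close> is already attached to
  \<open>d1\<close> and \<open>d2\<close>, hence not to \<open>d3\<close>. Then
  \<open>deep_pair\<close> makes \<open>z3\<close> a common neighbour of all three, against
  \<open>attach_le_2\<close>.\<close>

lemma two_same_component:
  assumes "d1 \<in> F" "d2 \<in> F" "d3 \<in> F" "d1 \<noteq> d2" "d1 \<noteq> d3" "d2 \<noteq> d3"
    "z1 \<in> C" "z2 \<in> C" "z3 \<in> C" "E d1 z1" "E d2 z2" "E d3 z3" "conn E C z1 z2"
  shows False
proof -
  note Q = component_C(1)[OF assms(7)] component_C(2)[of z1]
  have n13: "\<not> conn E C z1 z3" using attach_le_2[OF Q assms(1-6), of z1 z2 z3] assms component_C by blast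
  then have n23: "\<not> conn E C z2 z3" using assms(13) conn_trans by metis
  have "\<not> E d3 z1" "\<not> E d3 z2"
    using attach_le_2[OF Q assms(1-6), of z1 z2] assms component_C by blast+
  then have "E d1 z3" "E d2 z3" using deep_pair n13 n23 assms by blast+
  then show False
    using attach_le_2[OF connected_set_singleton[of E z3] _ assms(1-6), of z3 z3 z3] assms by blast
qed

text \<open>The three neighbours in \<open>C\<close> lie in different components, so every pair has
  a cross edge by \<open>deep_pair\<close>. No vertex of \<open>C\<close> sees all three, which
  forces the cross edges to go round cyclically.\<close>

lemma Fd_le_2:
  assumes "d1 \<in> Fd" "d2 \<in> Fd" "d3 \<in> Fd" "d1 \<noteq> d2" "d1 \<noteq> d3" "d2 \<noteq> d3"
  shows False
proof -
  obtain z1 z2 z3 where z: "z1 \<in> C" "z2 \<in> C" "z3 \<in> C" "E d1 z1" "E d2 z2" "E d3 z3"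
    using assms unfolding Fd_def by blast
  have dF: "d1 \<in> F" "d2 \<in> F" "d3 \<in> F" using assms unfolding Fd_def by blast+
  have n: "\<not> conn E C z1 z2" "\<not> conn E C z1 z3" "\<not> conn E C z2 z3"
    using two_same_component[of d1 d2 d3 z1 z2 z3] two_same_component[of d1 d3 d2 z1 z3 z2]
      two_same_component[of d2 d3 d1 z2 z3 z1] dF z assms by blast+
  have ne: "z1 \<noteq> z2" "z1 \<noteq> z3" "z2 \<noteq> z3" using n z conn_refl by metis+
  have three: "\<not> (E d1 w \<and> E d2 w \<and> E d3 w)" if "w \<in> C" for w
    using attach_le_2[OF connected_set_singleton[of E w] _ dF assms(4-6), of w w w] that by blast
  have o12: "E d1 z2 \<or> E d2 z1" and o13: "E d1 z3 \<or> E d3 z1" and o23: "E d2 z3 \<or> E d3 z2"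
    using deep_pair dF z n by blast+
  \<comment> \<open>In the 6-cycle \<open>d1\<close>, \<open>x\<close>, \<open>d2\<close>,
    \<open>y\<close>, \<open>d3\<close>, \<open>w\<close> the vertices \<open>d1\<close> and
    \<open>d2\<close> are joined by both sides of the cycle and through \<open>b\<close>.\<close>
  have cyc: False
    if "E d1 x" "E d2 x" "E d2 y" "E d3 y" "E d3 w" "E d1 w" "x \<noteq> y" "x \<noteq> w" "y \<noteq> w"
      "x \<in> C" "y \<in> C" "w \<in> C" for x y w
  proof -
    have "connected_set E {w, d3, y}" using that by (intro con_intros) (auto intro: sym)
    moreover have "d1 \<noteq> b" "d2 \<noteq> b" "d3 \<noteq> b" "x \<noteq> b" "y \<noteq> b" "w \<noteq> b" using dF that F_facts C_facts by blast+
    moreover have "d1 \<notin> {x, y, w}" "d2 \<notin> {x, y, w}" "d3 \<notin> {x, y, w}" using dF that F_facts(5) by blast+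
    ultimately show False using that dF F_facts assms(4-6)
      by (intro no_K23[of "{d1}" "{d2}" "{x}" "{b}" "{w, d3, y}"]) (auto intro: con_intros)
  qed
  show False
  proof (cases "E d1 z2")
    case True
    then have "\<not> E d3 z2" using three z by blast
    then have "E d2 z3" using o23 by blast
    then have "\<not> E d1 z3" using three z by blast
    then have "E d3 z1" using o13 by blast
    then show False using cyc[of z2 z3 z1] True \<open>E d2 z3\<close> z ne by auto
  next
    case False
    then have "E d2 z1" using o12 by blast
    then have "\<not> E d3 z1" using three z by blast
    then have "E d1 z3" using o13 by blast
    then have "\<not> E d2 z3" using three z by blast
    then have "E d3 z2" using o23 by blast
    then show False using cyc[of z1 z2 z3] \<open>E d2 z1\<close> \<open>E d1 z3\<close> z ne by auto
  qed
qed

lemma ex_exit_pair_end: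
  assumes "q \<in> F" "\<And>u v. u \<in> F \<Longrightarrow> v \<in> F \<Longrightarrow> E q u \<Longrightarrow> E q v \<Longrightarrow> u = v" "F \<noteq> {q}"
  shows "\<exists>p\<in>F. p \<noteq> q \<and> (\<forall>u\<in>F. E q u \<longrightarrow> u = p) \<and>
    (\<forall>u\<in>F - {q}. \<forall>v\<in>F - {q}. E p u \<longrightarrow> E p v \<longrightarrow> u = v)"
proof (cases "\<exists>p\<in>F. E q p")
  case True
  then obtain p where p: "p \<in> F" "E q p" by blast
  have "u = v" if "u \<in> F - {q}" "v \<in> F - {q}" "E p u" "E p v" for u v
    using degree_le_2[of p u v q] that p assms(1) sym by blast
  then show ?thesis using p assms irrefl by (intro bexI[of _ p]) blast+
next
  case False
  have "F - {q} \<noteq> {}" using assms by auto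
  then show ?thesis using ex_end[of "F - {q}"] False by blast
qed

text \<open>Otherwise \<open>b\<close> and \<open>d\<close> are joined through \<open>u\<close>,
  through \<open>u'\<close>, and through \<open>d'\<close> with \<open>Q\<close>.\<close>

lemma common_component_nbrs:
  assumes d: "d \<in> F" "d' \<in> F" "d \<noteq> d'" "connected_set E Q" "Q \<subseteq> C" "touches E {d} Q" "touches E {d'} Q"
    and u: "u \<in> F" "u' \<in> F" "u \<noteq> d'" "u' \<noteq> d'" "E d u" "E d u'"
  shows "u = u'"
proof (rule ccontr)
  assume ne: "u \<noteq> u'"
  obtain y where y: "y \<in> Q" "E d' y" using d by auto
  have "connected_set E (insert d' Q)" using y d by (intro con_intros) auto
  moreover have "b \<notin> Q" "d \<notin> Q" "u \<notin> Q" "u' \<notin> Q" "d' \<notin> Q" using d u F_facts C_facts by blast+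
  moreover have "d \<noteq> b" "d' \<noteq> b" "u \<noteq> b" "u' \<noteq> b" using d u F_facts by blast+
  moreover have "u \<noteq> d" "u' \<noteq> d" using u irrefl by auto
  ultimately show False using ne d u F_facts(2,3)
    by (intro no_K23[of "{b}" "{d}" "{u}" "{u'}" "insert d' Q"]) (auto intro: con_intros)
qed

text \<open>If both \<open>d\<close> and \<open>d'\<close> had further neighbours \<open>u\<close>
  and \<open>w\<close> in \<open>F\<close>, then \<open>u\<close>, \<open>w\<close>,
  \<open>z\<close> would be asteroidal: the connecting paths use \<open>b\<close>, \<open>d\<close>,
  and \<open>d'\<close> followed by \<open>Q\<close>. Coincidences and unwanted edges among them
  give K_{2,3} minors.\<close>

lemma common_component_one_sided:
  assumes d: "d \<in> F" "d' \<in> F" "d \<noteq> d'" "Fd \<subseteq> {d, d'}"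
    and Q: "connected_set E Q" "Q \<subseteq> C" "z \<in> Q" "z' \<in> Q" "E d z" "E d' z'"
    and u: "u \<in> F" "u \<noteq> d'" "E d u" and w: "w \<in> F" "w \<noteq> d" "E d' w"
  shows False
proof -
  have nQ: "b \<notin> Q" "d \<notin> Q" "u \<notin> Q" "w \<notin> Q" "d' \<notin> Q" using d Q u w F_facts C_facts by blast+
  have nb: "d \<noteq> b" "d' \<noteq> b" "u \<noteq> b" "w \<noteq> b" using d u w F_facts by blast+
  have ne: "u \<noteq> d" "w \<noteq> d'" using u w irrefl by auto
  have nd': "\<not> E d' u" if "u \<in> F" "u \<noteq> d'" "u \<noteq> d" "E d u" for u
  proof
    assume "E d' u"
    moreover have "u \<notin> Q" "u \<noteq> b" using that Q F_facts by blast+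
    ultimately show False using that nQ nb d Q F_facts(2,3)
      by (intro no_K23[of "{d}" "{d'}" "{u}" "{b}" Q]) (auto intro: con_intros)
  qed
  have ud': "\<not> E d' u" using nd' u ne by blast
  have wd: "\<not> E d w" using nd'[of w] w ne by blast
  have uw: "u \<noteq> w" using ud' w by auto
  have nuw: "\<not> E u w"
  proof
    assume "E u w"
    then show False using nQ nb ne uw d Q u w F_facts(2,3)
      by (intro no_K23[of "{d}" "{d'}" "{u, w}" "{b}" Q]) (auto intro: con_intros)
  qed
  have far: "\<not> E u y" "\<not> E y u" "\<not> E w y" "\<not> E y w" if "y \<in> Q" for y
    using that Q u w d ne sym unfolding Fd_def by blast+
  have QU: "Q \<subseteq> U" using Q C_facts(1) by blast
  have zC: "z \<in> C" using Q by blast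
  have 1: "misses E (insert b U) u w z"
    by (rule misses_path3[of _ _ b])
       (use zC u w nQ Q far F_facts C_facts sym in \<open>auto simp: nbhd_def\<close>)
  have 2: "misses E (insert b U) u z w"
    by (rule misses_path3[of _ _ d])
       (use zC u w d nQ Q far F_facts C_facts sym uw nuw wd ne in \<open>auto simp: nbhd_def\<close>)
  have "misses E (insert b U) w z' u"
    by (rule misses_path3[of _ _ d'])
       (use Q(4) QU u w d nQ Q far F_facts C_facts sym uw nuw ud' ne in \<open>auto simp: nbhd_def\<close>)
  moreover have "misses E (insert b U) z' z u"
  proof -
    have "Q \<subseteq> insert b U - nbhd E u" using QU far nQ unfolding nbhd_def by blast
    then show ?thesis using Q unfolding misses_def connected_set_def by (blast intro: conn_mono)
  qed
  ultimately have "misses E (insert b U) w z u" unfolding misses_def by (rule conn_trans)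
  with 1 2 show False using noAT has_ATI by metis
qed

text \<open>If the path of \<open>F\<close> through \<open>d\<close> extended by two vertices on
  both sides, its vertices \<open>u'\<close> and \<open>w'\<close> together with \<open>z\<close>
  would be asteroidal, via \<open>b\<close> and the two halves of the path.\<close>

lemma branch_one_sided:
  assumes d: "Fd = {d}" and u: "u \<in> F" "E d u" and w: "w \<in> F" "E d w" and ne: "u \<noteq> w"
    and u': "u' \<in> F" "E u u'" "u' \<noteq> d" and w': "w' \<in> F" "E w w'" "w' \<noteq> d"
  shows False
proof -
  obtain z where z: "z \<in> C" "E d z" and dF: "d \<in> F" using d unfolding Fd_def by blast
  have irr: "u \<noteq> d" "w \<noteq> d" "u' \<noteq> u" "w' \<noteq> w" using u w u' w' irrefl by auto
  have nuw: "\<not> E u w" using no_K4[of b d u w] dF u w F_facts by blast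
  then have n1: "u' \<noteq> w" "w' \<noteq> u" using u' w' sym by auto
  have cyc: False if "x \<in> F" "x \<noteq> d" "x \<noteq> u" "x \<noteq> w" "E x u" "E x w" for x
    using that dF u w ne irr F_facts
    by (intro no_K23[of "{d}" "{x}" "{u}" "{w}" "{b}"]) (auto intro: con_intros)
  have n2: "\<not> E u' w" "\<not> E w' u" "u' \<noteq> w'" using cyc[of u'] cyc[of w'] u' w' irr n1 sym by blast+
  have n3: "\<not> E d u'" "\<not> E d w'"
    using degree_le_2[of d u w u'] degree_le_2[of d u w w'] dF u w u' w' irr n1 ne by blast+
  have n4: "\<not> E u' w'"
  proof
    assume "E u' w'"
    then show False using dF u w ne irr n1 n2 u' w' F_facts
      by (intro no_K23[of "{d}" "{u', w'}" "{u}" "{w}" "{b}"]) (auto intro: con_intros sym)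
  qed
  have far: "\<not> E y z" "\<not> E z y" if "y \<in> F" "y \<noteq> d" for y
    using that d z sym unfolding Fd_def by blast+
  have 1: "misses E (insert b U) u' w' z"
    by (rule misses_path3[of _ _ b])
       (use z u' w' far[of u'] far[of w'] F_facts C_facts sym in \<open>auto simp: nbhd_def\<close>)
  have path: "misses E (insert b U) x' z y'"
    if "x' \<in> F" "x \<in> F" "y' \<in> F" "E x' x" "E x d" "x' \<noteq> y'" "x \<noteq> y'" "d \<noteq> y'" "\<not> E y' x'" "\<not> E y' x" "\<not> E y' d"
    for x' x y'
  proof -
    have "conn E (insert b U - nbhd E y') x' x" "x \<in> insert b U - nbhd E y'"
      "d \<in> insert b U - nbhd E y'" "z \<in> insert b U - nbhd E y'"
      using that F_facts(1) C_facts(1,5) z dF far[of y'] by (auto simp: nbhd_def intro!: conn_edge)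
    then show ?thesis unfolding misses_def using that z by (blast intro: conn_step)
  qed
  have 2: "misses E (insert b U) u' z w'"
    by (rule path[of _ u]) (use u u' w' n1 n2 n3 n4 sym in auto)
  have 3: "misses E (insert b U) w' z u'"
    by (rule path[of _ w]) (use w u' w' n1 n2 n3 n4 sym in auto)
  show False using noAT has_ATI[OF 1 3 2] by blast
qed

text \<open>The last two vertices to be consumed from \<open>F\<close> must include all that lead
  into \<open>C\<close>. The vertex \<open>q\<close> will replace \<open>b\<close>, so no vertex
  listed before \<open>p\<close> may see it; and \<open>p\<close>, the last of the list, must be an
  end of what remains without \<open>q\<close>.\<close>

lemma ex_exit_pair:
  assumes "F \<noteq> {}" "\<And>f. F \<noteq> {f}"
  shows "\<exists>p\<in>F. \<exists>q\<in>F. p \<noteq> q \<and> Fd \<subseteq> {p, q} \<and> (\<forall>u\<in>F. E q u \<longrightarrow> u = p) \<and>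
    (\<forall>u\<in>F - {q}. \<forall>v\<in>F - {q}. E p u \<longrightarrow> E p v \<longrightarrow> u = v)"
proof -
  have FdF: "Fd \<subseteq> F" unfolding Fd_def by blast
  consider "Fd = {}" | d where "Fd = {d}" | d d' where "d \<in> Fd" "d' \<in> Fd" "d \<noteq> d'" by blast
  then show ?thesis
  proof cases
    case 1
    obtain q where q: "q \<in> F" "\<forall>u\<in>F. \<forall>v\<in>F. E q u \<longrightarrow> E q v \<longrightarrow> u = v"
      using ex_end[OF subset_refl assms(1)] by blast
    then show ?thesis using ex_exit_pair_end[OF q(1) _ assms(2)] 1 by blast
  next
    case (2 d)
    then have dF: "d \<in> F" using FdF by blast
    show ?thesis
    proof (cases "\<forall>u\<in>F. \<forall>v\<in>F. E d u \<longrightarrow> E d v \<longrightarrow> u = v")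
      case True
      then have "u = v" if "u \<in> F" "v \<in> F" "E d u" "E d v" for u v using that by simp
      from ex_exit_pair_end[OF dF this assms(2)] obtain p where "p \<in> F" "p \<noteq> d"
        "\<forall>u\<in>F. E d u \<longrightarrow> u = p" "\<forall>u\<in>F - {d}. \<forall>v\<in>F - {d}. E p u \<longrightarrow> E p v \<longrightarrow> u = v"
        by blast
      then show ?thesis using dF 2 by (intro bexI[of _ p] bexI[of _ d]) auto
    next
      case False
      then obtain u w where uw: "u \<in> F" "w \<in> F" "E d u" "E d w" "u \<noteq> w" by blast
      have ne: "u \<noteq> d" "w \<noteq> d" using uw irrefl by auto
      have only: "x = u \<or> x = w" if "x \<in> F" "E d x" for x
        using degree_le_2[of d u w x] that uw dF by blast
      \<comment> \<open>One of \<open>u\<close>, \<open>w\<close> has no neighbour in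
        \<open>F\<close> but \<open>d\<close>; it serves as \<open>q\<close>, with \<open>d\<close>
        as \<open>p\<close>.\<close>
      have "(\<forall>x\<in>F. E u x \<longrightarrow> x = d) \<or> (\<forall>x\<in>F. E w x \<longrightarrow> x = d)"
        using branch_one_sided[OF 2] uw by blast
      moreover have "\<forall>x\<in>F - {u}. \<forall>y\<in>F - {u}. E d x \<longrightarrow> E d y \<longrightarrow> x = y"
        "\<forall>x\<in>F - {w}. \<forall>y\<in>F - {w}. E d x \<longrightarrow> E d y \<longrightarrow> x = y" using only by blast+
      moreover have "Fd \<subseteq> {d, u}" "Fd \<subseteq> {d, w}" using 2 by simp_all
      ultimately show ?thesis using dF uw(1,2) ne by metis
    qed
  next
    case (3 d d')
    have sub: "Fd \<subseteq> {d, d'}" using Fd_le_2[of d d'] 3 by blast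
    have dF: "d \<in> F" "d' \<in> F" using 3 FdF by blast+
    \<comment> \<open>If the two neighbours lie in different components of \<open>C\<close>, a cross
      edge from \<open>deep_pair\<close> provides a common neighbour instead.\<close>
    obtain z z' where z: "z \<in> C" "z' \<in> C" "E d z" "E d' z'" "conn E C z z'"
    proof -
      obtain z z' where z: "z \<in> C" "z' \<in> C" "E d z" "E d' z'" using 3 unfolding Fd_def by blast
      show thesis
      proof (cases "conn E C z z'")
        case True then show thesis using that z by blast
      next
        case False
        then have "E d z' \<or> E d' z" using deep_pair dF z by blast
        then show thesis using that[of z' z'] that[of z z] z conn_refl by metis
      qed
    qed
    let ?Q = "{y. conn E C z y}"
    have Q: "connected_set E ?Q" "?Q \<subseteq> C" "z \<in> ?Q" "z' \<in> ?Q" using component_C z by auto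
    have t: "touches E {d} ?Q" "touches E {d'} ?Q" using z Q by auto
    have n: "u = u'" if "u \<in> F - {d'}" "u' \<in> F - {d'}" "E d u" "E d u'" for u u'
      using common_component_nbrs[OF dF 3(3) Q(1,2) t] that by blast
    have n': "u = u'" if "u \<in> F - {d}" "u' \<in> F - {d}" "E d' u" "E d' u'" for u u'
      using common_component_nbrs[OF dF(2,1) 3(3)[symmetric] Q(1,2) t(2,1)] that by blast
    have "(\<forall>u\<in>F. E d u \<longrightarrow> u = d') \<or> (\<forall>u\<in>F. E d' u \<longrightarrow> u = d)"
      using common_component_one_sided[OF dF 3(3) sub Q z(3,4)] by blast
    then show ?thesis
    proof
      assume "\<forall>u\<in>F. E d u \<longrightarrow> u = d'"
      then show ?thesis using sub dF 3(3) n' by (intro bexI[of _ d'] bexI[of _ d]) auto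
    next
      assume "\<forall>u\<in>F. E d' u \<longrightarrow> u = d"
      then show ?thesis using sub dF 3(3) n by (intro bexI[of _ d] bexI[of _ d']) auto
    qed
  qed
qed

end

section \<open>States of the sweep and the induction over them\<close>

definition dead :: "('a \<Rightarrow> 'a \<Rightarrow> bool) \<Rightarrow> 'a option \<Rightarrow> 'a set \<Rightarrow> bool" where
  "dead E x U \<longleftrightarrow> (\<forall>y u. x = Some y \<longrightarrow> u \<in> U \<longrightarrow> \<not> E y u)"

context K23_K4_free
begin

text \<open>The processed vertices other than \<open>b\<close> are forgotten; \<open>b\<close> has
  become the admissible vertex of what remains.\<close>

definition single_state :: "'a set \<Rightarrow> 'a \<Rightarrow> bool" where
  "single_state U b \<longleftrightarrow> finite U \<and> b \<notin> U \<and> \<not> has_AT E (insert b U) \<and> admissible E (insert b U) b"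

text \<open>The two connections from \<open>s\<close>, each avoiding the other active vertex, supply
  the set \<open>S\<close> of \<open>not_stuck\<close> and the paths that carry obstructions back to
  \<open>s\<close>.\<close>

definition double_state :: "'a set \<Rightarrow> 'a set \<Rightarrow> 'a \<Rightarrow> 'a \<Rightarrow> 'a \<Rightarrow> bool" where
  "double_state W U s t b \<longleftrightarrow> finite U \<and> W \<inter> U = {} \<and> \<not> has_AT E (W \<union> U) \<and> admissible E (W \<union> U) s \<and>
     s \<in> W - {t, b} \<and> t \<noteq> b \<and> conn E (W - {b}) s t \<and> conn E (W - {t}) s b \<and>
     (\<forall>w\<in>W. \<forall>u\<in>U. E w u \<longrightarrow> w = t \<or> w = b)"

lemma double_state_commute: "double_state W U s t b \<Longrightarrow> double_state W U s b t"
  unfolding double_state_def by auto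

lemma double_state_advance:
  assumes "double_state W U s t b" "v \<in> U" "E t v" "\<And>u. u \<in> U \<Longrightarrow> E t u \<Longrightarrow> u = v"
  shows "double_state (insert v W) (U - {v}) s v b"
proof -
  note d = assms(1)[unfolded double_state_def]
  have eq: "insert v W \<union> (U - {v}) = W \<union> U" using assms(2) by auto
  have bW: "b \<in> W" "t \<in> W" using d conn_in by fast+
  have vW: "v \<notin> W" using d assms(2) by blast
  have "conn E (insert v W - {b}) s t" by (rule conn_mono[of _ "W - {b}"]) (use d in blast)+
  then have 1: "conn E (insert v W - {b}) s v" by (rule conn_step) (use assms(3) bW vW in blast)+
  have 2: "conn E (insert v W - {v}) s b" by (rule conn_mono[of _ "W - {t}"]) (use d vW in blast)+
  have 3: "w = v \<or> w = b" if "w \<in> insert v W" "u \<in> U - {v}" "E w u" for w u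
    using that d assms(4)[of u] by blast
  have "s \<noteq> v" "v \<noteq> b" using d vW bW by blast+
  then show ?thesis unfolding double_state_def eq using d 1 2 3 by blast
qed

text \<open>If stuck, \<open>not_stuck\<close> applies to the component of \<open>s\<close> without
  \<open>t\<close> and \<open>b\<close>. It yields private nonadjacent neighbours \<open>x\<close>,
  \<open>y\<close>, which \<open>s\<close> reaches through \<open>t\<close> and through
  \<open>b\<close>, against admissibility.\<close>

lemma double_state_progress:
  assumes "double_state W U s t b"
  shows "\<exists>v. (\<forall>u\<in>U. E t u \<longrightarrow> u = v) \<or> (\<forall>u\<in>U. E b u \<longrightarrow> u = v)"
proof (rule ccontr)
  assume "\<not> ?thesis"
  then obtain x1 x2 y1 y2 where
    x: "x1 \<in> U" "x2 \<in> U" "x1 \<noteq> x2" "E t x1" "E t x2" and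
    y: "y1 \<in> U" "y2 \<in> U" "y1 \<noteq> y2" "E b y1" "E b y2" by metis
  note d = assms[unfolded double_state_def]
  let ?S = "{z. conn E (W - {t, b}) s z}"
  have S: "connected_set E ?S" by (rule connected_set_component[OF symE]) (use d in auto)
  have bW: "b \<in> W" "t \<in> W" using d conn_in by fast+
  have SW: "?S \<subseteq> W - {t, b}" by (auto dest: conn_in)
  have eqs: "W - {b} - {t} = W - {t, b}" "W - {t} - {b} = W - {t, b}" by auto
  have t: "touches E {t} ?S" "touches E {b} ?S"
    using conn_last_step[of E "W - {b}" s t] conn_last_step[of E "W - {t}" s b] d sym
    unfolding eqs by auto
  obtain x y where xy: "x \<in> U" "y \<in> U" "E t x" "\<not> E b x" "E b y" "\<not> E t y" "\<not> E x y" "x \<noteq> y"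
    using not_stuck[OF _ S _ _ _ t _ _ x y] d bW SW by blast
  have m: "misses E (W \<union> U) s x y"
    if "x \<in> U" "y \<in> U" "E t x" "\<not> E t y" "\<not> E x y" "x \<noteq> y" "conn E (W - {b}) s t"
      "\<forall>w\<in>W. \<forall>u\<in>U. E w u \<longrightarrow> w = t \<or> w = b" for x y t b
  proof -
    have "W - {b} \<subseteq> W \<union> U - nbhd E y"
      using that d sym unfolding nbhd_def by blast
    then have "conn E (W \<union> U - nbhd E y) s t" using that conn_mono by metis
    moreover have "x \<in> W \<union> U - nbhd E y" using that sym unfolding nbhd_def by blast
    ultimately show ?thesis unfolding misses_def using that conn_step by metis
  qed
  have "misses E (W \<union> U) s x y" by (rule m[of _ _ t b]) (use xy d in auto)
  moreover have "misses E (W \<union> U) s y x" by (rule m[of _ _ b t]) (use xy d sym in auto)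
  ultimately show False using d xy unfolding admissible_def by blast
qed

text \<open>Every path from \<open>b\<close> can be preceded by one from \<open>s\<close> to
  \<open>b\<close>: once \<open>t\<close> sees nothing of \<open>U\<close>, a vertex
  \<open>z\<close> of \<open>U\<close> not adjacent to \<open>b\<close> sees nothing of
  \<open>W\<close>.\<close>

lemma double_state_single:
  assumes "double_state W U s t b" "\<And>u. u \<in> U \<Longrightarrow> \<not> E t u"
  shows "single_state U b"
proof -
  note d = assms(1)[unfolded double_state_def]
  have bW: "b \<in> W" using d conn_in by fast
  have "misses E (W \<union> U) s y z" if "misses E (insert b U) b y z" "z \<in> U" for y z
  proof -
    have "b \<notin> nbhd E z" using misses_in(3)[OF that(1)] .
    then have "W \<subseteq> W \<union> U - nbhd E z" using d that(2) assms(2) sym unfolding nbhd_def by blast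
    then have "conn E (W \<union> U - nbhd E z) s b" using d conn_mono[of E "W - {t}" s b] by blast
    moreover have "conn E (W \<union> U - nbhd E z) b y"
      using that(1) bW unfolding misses_def by (auto elim!: conn_mono)
    ultimately show ?thesis unfolding misses_def by (rule conn_trans)
  qed
  moreover have "z \<in> U" if "misses E (insert b U) b y z" "z \<in> insert b U" for y z
    using that misses_in(3)[OF that(1)] by (auto simp: nbhd_def)
  ultimately have "admissible E (insert b U) b"
    using d unfolding admissible_def by (metis Un_iff insertI1)
  moreover have "\<not> has_AT E (insert b U)" using d bW has_AT_mono[of E "insert b U" "W \<union> U"] by blast
  ultimately show ?thesis using d bW unfolding single_state_def by blast
qed

text \<open>As \<open>m\<close> is the only neighbour of \<open>b\<close>, a path from
  \<open>m\<close> avoiding the closed neighbourhood of \<open>z\<close> can be preceded by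
  \<open>b\<close>.\<close>

lemma single_state_advance:
  assumes "single_state U b" "m \<in> U" "E b m" "\<And>u. u \<in> U \<Longrightarrow> E b u \<Longrightarrow> u = m"
  shows "single_state (U - {m}) m"
proof -
  note d = assms(1)[unfolded single_state_def]
  have eq: "insert m (U - {m}) = U" using assms(2) by auto
  have "misses E (insert b U) b y z" if "misses E U m y z" "z \<in> U" for y z
  proof -
    have "m \<notin> nbhd E z" using misses_in(3)[OF that(1)] .
    then have "b \<notin> nbhd E z" using that(2) assms(4) d sym unfolding nbhd_def by blast
    then have "conn E (insert b U - nbhd E z) b m"
      using assms(2,3) \<open>m \<notin> nbhd E z\<close> by (intro conn_edge) auto
    moreover have "conn E (insert b U - nbhd E z) m y"
      using that(1) unfolding misses_def by (auto elim!: conn_mono)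
    ultimately show ?thesis unfolding misses_def by (rule conn_trans)
  qed
  then have "admissible E U m" using d assms(2) unfolding admissible_def by blast
  moreover have "\<not> has_AT E U" using d has_AT_mono[of E U "insert b U"] by blast
  ultimately show ?thesis using d unfolding single_state_def eq by blast
qed

text \<open>The parts treat no, one and two active vertices with unprocessed neighbours. They need
  each other, since a step may start a new component, open a fan or let a vertex die.\<close>

lemma layouts:
  "(\<forall>x y. finite U \<longrightarrow> \<not> has_AT E U \<longrightarrow> dead E x U \<longrightarrow> dead E y U \<longrightarrow> layout E U x y) \<and>
   (\<forall>x b. single_state U b \<longrightarrow> dead E x U \<longrightarrow> layout E U x (Some b)) \<and>
   (\<forall>W s t b. double_state W U s t b \<longrightarrow> layout E U (Some t) (Some b))"
proof (induction "card U" arbitrary: U rule: less_induct)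
  case less
  have IH1: "layout E U' x (Some b)" if "U' \<subset> U" "finite U" "single_state U' b" "dead E x U'" for U' x b
    using less.hyps[OF psubset_card_mono[OF that(2,1)]] that(3-) by blast
  have IH2: "layout E U' (Some t) (Some b)" if "U' \<subset> U" "finite U" "double_state W U' s t b" for U' W s t b
    using less.hyps[OF psubset_card_mono[OF that(2,1)]] that(3-) by blast
  have Z: "layout E U x y" if fin: "finite U" and at: "\<not> has_AT E U" and dx: "dead E x U" and dy: "dead E y U" for x y
  proof (cases "U = {}")
    case True then show ?thesis by (simp add: layout_empty)
  next
    case False
    then obtain s where s: "admissible E U s" using ex_admissible[OF symE fin _ at] by blast
    then have sU: "s \<in> U" by (simp add: admissible_def)
    then have eq: "insert s (U - {s}) = U" by auto
    have "single_state (U - {s}) s" unfolding single_state_def eq using fin at s by simp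
    moreover have "dead E y (U - {s})" using dy by (auto simp: dead_def)
    ultimately have "layout E (U - {s}) y (Some s)" using IH1[of "U - {s}" s y] sU fin by blast
    then show ?thesis using layout_left[OF sU] dx layout_commute unfolding dead_def by blast
  qed
  have S: "layout E U x (Some b)" if st: "single_state U b" and x: "dead E x U" for x b
  proof -
    note d = st[unfolded single_state_def]
    define F where "F = {f \<in> U. E b f}"
    consider "F = {}" | m where "F = {m}" | "F \<noteq> {}" "\<And>f. F \<noteq> {f}" by blast
    then show ?thesis
    proof cases
      case 1
      then have "dead E (Some b) U" unfolding F_def dead_def by blast
      moreover have "\<not> has_AT E U" using d has_AT_mono[of E U "insert b U"] by blast
      ultimately show ?thesis using Z d x by blast
    next
      case (2 m)
      then have m: "m \<in> U" "E b m" "\<And>u. u \<in> U \<Longrightarrow> E b u \<Longrightarrow> u = m" unfolding F_def by auto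
      have "dead E x (U - {m})" using x by (auto simp: dead_def)
      then have "layout E (U - {m}) x (Some m)"
        using IH1[of "U - {m}" m x] single_state_advance[OF st m] m d by blast
      then show ?thesis using layout_right[OF m(1)] m(3) by blast
    next
      case 3
      interpret fan E U b F "U - F" "{f \<in> F. \<exists>z\<in>U - F. E f z}"
        by unfold_locales (use d F_def in auto)
      obtain p q where pq: "p \<in> F" "q \<in> F" "p \<noteq> q" "{f \<in> F. \<exists>z\<in>U - F. E f z} \<subseteq> {p, q}"
        "\<forall>u\<in>F. E q u \<longrightarrow> u = p" "\<forall>u\<in>F - {q}. \<forall>v\<in>F - {q}. E p u \<longrightarrow> E p v \<longrightarrow> u = v"
        using ex_exit_pair[OF 3] by blast
      obtain rs where rs: "forward_path E rs" "distinct rs" "set rs = F - {q}" "rs \<noteq> []" "last rs = p"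
        using ex_forward_path[of "F - {q}" p] pq by blast
      have FU: "F \<subseteq> U" unfolding F_def by blast
      \<comment> \<open>After the fan has been consumed, \<open>p\<close> and \<open>q\<close> are
        active and the former \<open>b\<close> takes the part of the admissible vertex.\<close>
      have D: "double_state (insert b F) (U - F) b p q"
      proof -
        have eq: "insert b F \<union> (U - F) = insert b U" using FU by auto
        have bne: "b \<noteq> p" "b \<noteq> q" using pq(1,2) F_facts(4) by blast+
        have c: "conn E (insert b F - {q}) b p" "conn E (insert b F - {p}) b q"
          by (rule conn_edge; use pq(1-3) bne F_facts(2) in blast)+
        have "w = p \<or> w = q" if "w \<in> insert b F" "u \<in> U - F" "E w u" for w u
          using that pq(4) unfolding F_def by blast
        then show ?thesis unfolding double_state_def eq using d FU pq(3) bne c by blast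
      qed
      have U': "U - set rs - {q} = U - F" using rs(3) pq(2) by auto
      have "layout E (U - set rs - {q}) (Some p) (Some q)"
        unfolding U' by (rule IH2[OF _ _ D]) (use FU pq d in auto)
      \<comment> \<open>Now \<open>q\<close> is the only unprocessed neighbour of \<open>b\<close>
        and may replace it.\<close>
      then have "layout E (U - set rs) (Some (last rs)) (Some b)"
        unfolding rs(5) by (rule layout_right[rotated 2]) (use rs(3) pq FU F_def in auto)
      then show ?thesis
      proof (rule layout_forward_path[OF rs(1,4,2), where S = "F - {q}", rotated -1])
        show "set rs \<subseteq> U" using rs(3) FU by auto
        show "u = hd rs" if "x = Some y" "u \<in> U" "E y u" for y u using x that unfolding dead_def by blast
        show "u \<in> F - {q}" if r: "r \<in> set (butlast rs)" and u: "u \<in> U" "E r u" for r u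
        proof -
          have rF: "r \<in> F - {q}" using in_set_butlastD[OF r] rs(3) by blast
          have "rs = butlast rs @ [p]" using rs(4,5) by (metis append_butlast_last_id)
          then have "r \<noteq> p" using r rs(2) by (metis distinct_append disjoint_insert(1) list.set(2))
          \<comment> \<open>Vertices of the list before \<open>p\<close> have no neighbour in
            \<open>U - F\<close> and are not adjacent to \<open>q\<close>.\<close>
          then show ?thesis using rF u pq sym by blast
        qed
        show "(F - {q}) \<inter> U \<subseteq> set rs" using rs(3) by auto
      qed (rule irrefl)
    qed
  qed
  have D: "layout E U (Some t) (Some b)" if dst: "double_state W U s t b" for W s t b
  proof -
    have step: "layout E U (Some t) (Some b)"
      if dst: "double_state W U s t b" and v: "\<forall>u\<in>U. E t u \<longrightarrow> u = v" for t b v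
    proof (cases "\<exists>u\<in>U. E t u")
      case True
      then have v': "v \<in> U" "E t v" using v by auto
      have "U - {v} \<subset> U" "finite U" using v'(1) dst unfolding double_state_def by blast+
      moreover have "double_state (insert v W) (U - {v}) s v b"
        by (rule double_state_advance[OF dst v']) (use v in blast)
      ultimately have "layout E (U - {v}) (Some v) (Some b)" by (rule IH2)
      then show ?thesis by (rule layout_left[OF v'(1), rotated]) (use v in blast)
    next
      case False
      then show ?thesis using S[OF double_state_single[OF dst]] unfolding dead_def by blast
    qed
    obtain v where "(\<forall>u\<in>U. E t u \<longrightarrow> u = v) \<or> (\<forall>u\<in>U. E b u \<longrightarrow> u = v)"
      using double_state_progress[OF dst] by blast
    then show ?thesis
      using step[OF dst] step[OF double_state_commute[OF dst]] layout_commute by blast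
  qed
  show ?case using Z S D by blast
qed

lemma ex_start_layout:
  assumes "finite V" "V \<noteq> {}" "\<not> has_AT E V"
  shows "\<exists>s\<in>V. layout E (V - {s}) (Some s) None"
proof -
  obtain s where s: "admissible E V s" using ex_admissible[OF symE] assms by blast
  then have sV: "s \<in> V" by (simp add: admissible_def)
  then have eq: "insert s (V - {s}) = V" by auto
  have "single_state (V - {s}) s" unfolding single_state_def eq using assms s by simp
  then have "layout E (V - {s}) None (Some s)" using layouts[of "V - {s}"] by (simp add: dead_def)
  then show ?thesis using layout_commute sV by blast
qed

end
section \<open>Theta curves and forbidden minors\<close>

lemma Jordan_two_arcs:
  fixes p q :: "real \<Rightarrow> complex"
  assumes "arc p" "arc q" "pathstart p = a" "pathfinish p = b" "pathstart q = a" "pathfinish q = b"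
    "path_image p \<inter> path_image q = {a, b}"
  defines "K \<equiv> path_image p \<union> path_image q"
  shows "inside K \<noteq> {}" "connected (inside K)" "connected (outside K)" "open (inside K)" "open (outside K)"
    "inside K \<inter> outside K = {}" "inside K \<union> outside K = - K" "frontier (inside K) = K" "compact K"
proof -
  let ?g = "p +++ reversepath q"
  have s: "simple_path ?g" using assms by (intro simple_path_join_loop) (auto simp: arc_reversepath)
  have c: "pathfinish ?g = pathstart ?g" using assms by simp
  have K: "path_image ?g = K" using assms by (simp add: path_image_join K_def)
  show "inside K \<noteq> {}" "connected (inside K)" "connected (outside K)" "open (inside K)" "open (outside K)"
    "inside K \<inter> outside K = {}" "inside K \<union> outside K = - K" "frontier (inside K) = K"
    using Jordan_inside_outside[OF s c] unfolding K by auto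
  show "compact K" unfolding K_def using assms by (auto intro!: compact_Un compact_path_image arc_imp_path)
qed

lemma connected_component_outside:
  fixes K :: "complex set"
  assumes "connected (outside K)" "x \<in> outside K" "y \<in> outside K"
  shows "connected_component (- K) x y"
  unfolding connected_component_def using assms outside_no_overlap[of K] by blast

lemma connected_subset_inside:
  fixes p q :: "real \<Rightarrow> complex"
  assumes "arc p" "arc q" "pathstart p = a" "pathfinish p = b" "pathstart q = a" "pathfinish q = b"
    "path_image p \<inter> path_image q = {a, b}"
    "connected T" "T \<inter> (path_image p \<union> path_image q) = {}"
    "T \<inter> inside (path_image p \<union> path_image q) \<noteq> {}"
  shows "T \<subseteq> inside (path_image p \<union> path_image q)"
proof -
  note J = Jordan_two_arcs[OF assms(1-7)]
  have "T \<subseteq> inside (path_image p \<union> path_image q) \<union> outside (path_image p \<union> path_image q)"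
    using assms(9) J(7) by blast
  then show ?thesis using connectedD[OF assms(8) J(4,5)] J(6) assms(10) by blast
qed

text \<open>Otherwise a point inside the curve \<open>c2 \<union> c3\<close> and a point outside all three arcs are separated
  neither by \<open>c1 \<union> c2\<close> nor by \<open>c1 \<union> c3\<close>, unless two of the three bounded regions coincide. As these
  two curves meet in the connected set \<open>c1\<close>, Janiszewski's theorem applies.\<close>

lemma theta_some_inside:
  fixes c1 c2 c3 :: "real \<Rightarrow> complex"
  assumes arcs: "arc c1" "arc c2" "arc c3"
    and ends: "pathstart c1 = a" "pathfinish c1 = b" "pathstart c2 = a" "pathfinish c2 = b"
      "pathstart c3 = a" "pathfinish c3 = b"
    and ints: "path_image c1 \<inter> path_image c2 = {a, b}" "path_image c1 \<inter> path_image c3 = {a, b}"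
      "path_image c2 \<inter> path_image c3 = {a, b}"
  shows "path_image c1 \<inter> inside (path_image c2 \<union> path_image c3) \<noteq> {} \<or>
    path_image c2 \<inter> inside (path_image c1 \<union> path_image c3) \<noteq> {} \<or>
    path_image c3 \<inter> inside (path_image c1 \<union> path_image c2) \<noteq> {}"
proof (rule ccontr)
  let ?P1 = "path_image c1" and ?P2 = "path_image c2" and ?P3 = "path_image c3"
  assume "\<not> ?thesis"
  then have n: "?P1 \<inter> inside (?P2 \<union> ?P3) = {}" "?P2 \<inter> inside (?P1 \<union> ?P3) = {}"
    "?P3 \<inter> inside (?P1 \<union> ?P2) = {}" by auto
  note J12 = Jordan_two_arcs[OF arcs(1,2) ends(1-4) ints(1)]
  note J13 = Jordan_two_arcs[OF arcs(1,3) ends(1,2,5,6) ints(2)]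
  note J23 = Jordan_two_arcs[OF arcs(2,3) ends(3-6) ints(3)]
  obtain x where x: "x \<in> inside (?P2 \<union> ?P3)" using J23(1) by blast
  have "compact (?P1 \<union> ?P2 \<union> ?P3)" 
    using arcs by (intro compact_Un compact_path_image arc_imp_path)
  then have "outside (?P1 \<union> ?P2 \<union> ?P3) \<noteq> {}"
    by (intro outside_bounded_nonempty compact_imp_bounded)
  then obtain y where y: "y \<in> outside (?P1 \<union> ?P2 \<union> ?P3)" by blast
  then have y': "y \<in> outside (?P1 \<union> ?P2)" "y \<in> outside (?P1 \<union> ?P3)" "y \<in> outside (?P2 \<union> ?P3)"
    using outside_mono[of _ "?P1 \<union> ?P2 \<union> ?P3"] by blast+
  have xn: "x \<notin> ?P1" "x \<notin> ?P2" "x \<notin> ?P3" using x n(1) inside_no_overlap[of "?P2 \<union> ?P3"] by blast+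
  have mid: "\<exists>z. z \<in> path_image c - {a, b}" if "arc c" "pathstart c = a" "pathfinish c = b" for c :: "real \<Rightarrow> complex"
  proof -
    have "c (1/2) \<noteq> c 0" "c (1/2) \<noteq> c 1" using that(1) unfolding arc_def inj_on_def by force+
    moreover have "c (1/2) \<in> path_image c" unfolding path_image_def by auto
    ultimately show ?thesis using that unfolding pathstart_def pathfinish_def by blast
  qed
  have "x \<in> inside (?P1 \<union> ?P2) \<or> x \<in> inside (?P1 \<union> ?P3)"
  proof (rule ccontr)
    assume "\<not> ?thesis"
    then have xo: "x \<in> outside (?P1 \<union> ?P2)" "x \<in> outside (?P1 \<union> ?P3)" using xn J12(7) J13(7) by blast+
    have "(?P1 \<union> ?P2) \<inter> (?P1 \<union> ?P3) = ?P1" using ints by blast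
    then have "connected ((?P1 \<union> ?P2) \<inter> (?P1 \<union> ?P3))" using arcs(1) by (simp add: connected_arc_image)
    then have "connected_component (- ((?P1 \<union> ?P2) \<union> (?P1 \<union> ?P3))) x y"
      by (rule Janiszewski[OF J12(9) compact_imp_closed[OF J13(9)] _
            connected_component_outside[OF J12(3) xo(1) y'(1)]
            connected_component_outside[OF J13(3) xo(2) y'(2)]])
    then have "connected_component (- (?P2 \<union> ?P3)) x y"
      by (rule connected_component_of_subset) auto
    then have "y \<in> inside (?P2 \<union> ?P3)" using x inside_same_component by blast
    then show False using y'(3) J23(6) by blast
  qed
  then show False
  proof
    assume x1: "x \<in> inside (?P1 \<union> ?P2)"
    have "inside (?P2 \<union> ?P3) \<subseteq> inside (?P1 \<union> ?P2)"
      by (rule connected_subset_inside[OF arcs(1,2) ends(1-4) ints(1) J23(2)])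
         (use n x x1 inside_no_overlap[of "?P2 \<union> ?P3"] in blast)+
    moreover have "inside (?P1 \<union> ?P2) \<subseteq> inside (?P2 \<union> ?P3)"
      by (rule connected_subset_inside[OF arcs(2,3) ends(3-6) ints(3) J12(2)])
         (use n x x1 inside_no_overlap[of "?P1 \<union> ?P2"] in blast)+
    \<comment> \<open>Equal insides have equal frontiers, but an inner point of \<open>c1\<close>
      lies on neither \<open>c2\<close> nor \<open>c3\<close>.\<close>
    ultimately have "?P1 \<union> ?P2 = ?P2 \<union> ?P3" using J12(8) J23(8) by (metis subset_antisym)
    then show False using mid[OF arcs(1) ends(1,2)] ints by blast
  next
    assume x1: "x \<in> inside (?P1 \<union> ?P3)"
    have "inside (?P2 \<union> ?P3) \<subseteq> inside (?P1 \<union> ?P3)"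
      by (rule connected_subset_inside[OF arcs(1,3) ends(1,2,5,6) ints(2) J23(2)])
         (use n x x1 inside_no_overlap[of "?P2 \<union> ?P3"] in blast)+
    moreover have "inside (?P1 \<union> ?P3) \<subseteq> inside (?P2 \<union> ?P3)"
      by (rule connected_subset_inside[OF arcs(2,3) ends(3-6) ints(3) J13(2)])
         (use n x x1 inside_no_overlap[of "?P1 \<union> ?P3"] in blast)+
    ultimately have "?P1 \<union> ?P3 = ?P2 \<union> ?P3" using J13(8) J23(8) by (metis subset_antisym)
    then show False using mid[OF arcs(1) ends(1,2)] ints by blast
  qed
qed

text \<open>An open arc is connected and misses the curve formed by the other two, so one of its
  points off the inside keeps it off entirely. With \<open>c1\<close> and \<open>c2\<close>
  excluded, \<open>theta_some_inside\<close> leaves only \<open>c3\<close>.\<close>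

lemma theta_third_inside:
  fixes c1 c2 c3 :: "real \<Rightarrow> complex"
  assumes arcs: "arc c1" "arc c2" "arc c3"
    and ends: "pathstart c1 = a" "pathfinish c1 = b" "pathstart c2 = a" "pathfinish c2 = b"
      "pathstart c3 = a" "pathfinish c3 = b"
    and ints: "path_image c1 \<inter> path_image c2 = {a, b}" "path_image c1 \<inter> path_image c3 = {a, b}"
      "path_image c2 \<inter> path_image c3 = {a, b}"
    and w1: "w1 \<in> path_image c1 - {a, b}" "w1 \<notin> inside (path_image c2 \<union> path_image c3)"
    and w2: "w2 \<in> path_image c2 - {a, b}" "w2 \<notin> inside (path_image c1 \<union> path_image c3)"
  shows "path_image c3 - {a, b} \<subseteq> inside (path_image c1 \<union> path_image c2)"
    "path_image c3 \<inter> inside (path_image c1 \<union> path_image c2) \<noteq> {}"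
proof -
  have conn: "connected (path_image c - {a, b})" if "arc c" "pathstart c = a" "pathfinish c = b" for c :: "real \<Rightarrow> complex"
    using connected_simple_path_endless[OF arc_imp_simple_path[OF that(1)]] that by simp
  have "path_image c1 \<inter> inside (path_image c2 \<union> path_image c3) = {}"
  proof (rule ccontr)
    assume "\<not> ?thesis"
    moreover have "a \<notin> inside (path_image c2 \<union> path_image c3)" "b \<notin> inside (path_image c2 \<union> path_image c3)"
      using inside_no_overlap[of "path_image c2 \<union> path_image c3"] ints by blast+
    ultimately have "path_image c1 - {a, b} \<subseteq> inside (path_image c2 \<union> path_image c3)"
      by (intro connected_subset_inside[OF arcs(2,3) ends(3-6) ints(3) conn[OF arcs(1) ends(1,2)]]) (use ints in blast)+
    then show False using w1 by blast
  qed
  moreover have "path_image c2 \<inter> inside (path_image c1 \<union> path_image c3) = {}"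
  proof (rule ccontr)
    assume "\<not> ?thesis"
    moreover have "a \<notin> inside (path_image c1 \<union> path_image c3)" "b \<notin> inside (path_image c1 \<union> path_image c3)"
      using inside_no_overlap[of "path_image c1 \<union> path_image c3"] ints by blast+
    ultimately have "path_image c2 - {a, b} \<subseteq> inside (path_image c1 \<union> path_image c3)"
      by (intro connected_subset_inside[OF arcs(1,3) ends(1,2,5,6) ints(2) conn[OF arcs(2) ends(3,4)]]) (use ints in blast)+
    then show False using w2 by blast
  qed
  ultimately show ne: "path_image c3 \<inter> inside (path_image c1 \<union> path_image c2) \<noteq> {}"
    using theta_some_inside[OF arcs ends ints] by blast
  moreover have "a \<notin> inside (path_image c1 \<union> path_image c2)" "b \<notin> inside (path_image c1 \<union> path_image c2)"
    using inside_no_overlap[of "path_image c1 \<union> path_image c2"] ints by blast+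
  ultimately show "path_image c3 - {a, b} \<subseteq> inside (path_image c1 \<union> path_image c2)"
    by (intro connected_subset_inside[OF arcs(1,2) ends(1-4) ints(1) conn[OF arcs(3) ends(5,6)]]) (use ints in blast)+
qed

section \<open>From K_{2,3} minors to theta subgraphs\<close>

lemma conn_path:
  assumes "conn E A x y"
  shows "\<exists>xs. xs \<noteq> [] \<and> distinct xs \<and> successively E xs \<and> set xs \<subseteq> A \<and> hd xs = x \<and> last xs = y"
  using assms
proof (induction rule: conn_induct)
  case refl then show ?case by (intro exI[of _ "[x]"]) auto
next
  case (step y z)
  then obtain xs where xs: "xs \<noteq> []" "distinct xs" "successively E xs" "set xs \<subseteq> A" "hd xs = x" "last xs = y"
    by blast
  show ?case
  proof (cases "z \<in> set xs")
    case True
    then obtain as bs where s: "xs = as @ z # bs" by (meson split_list)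
    have "successively E (as @ [z])" using xs(3) s by (auto simp: successively_append_iff)
    moreover have "hd (as @ [z]) = x" using xs(5) s by (cases as) auto
    ultimately show ?thesis using xs s by (intro exI[of _ "as @ [z]"]) auto
  next
    case False
    then show ?thesis using xs step by (intro exI[of _ "xs @ [z]"]) (auto simp: successively_append_iff)
  qed
qed

lemma successively_rev_symp:
  assumes "symp E" shows "successively E (rev xs) \<longleftrightarrow> successively E xs"
proof -
  have "(\<lambda>x y. E y x) = E" using assms by (auto simp: fun_eq_iff dest: sympD)
  then have "successively (\<lambda>x y. E y x) xs = successively E xs" by (rule arg_cong)
  then show ?thesis by (simp only: successively_rev)
qed

text \<open>Take a path from \<open>x1\<close> to \<open>x2\<close> and follow a path from
  \<open>x3\<close> up to its first vertex \<open>c\<close> on it. Each leg omits \<open>c\<close>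
  and may be empty.\<close>

lemma connected_set_tripod:
  assumes "symp E" "connected_set E X" "x1 \<in> X" "x2 \<in> X" "x3 \<in> X"
  shows "\<exists>c P Q R. (\<forall>(S, x) \<in> {(P, x1), (Q, x2), (R, x3)}. distinct (c # S) \<and> successively E (c # S) \<and>
      set (c # S) \<subseteq> X \<and> last (c # S) = x) \<and> set P \<inter> set Q = {} \<and> set P \<inter> set R = {} \<and> set Q \<inter> set R = {}"
proof -
  obtain xs where xs: "xs \<noteq> []" "distinct xs" "successively E xs" "set xs \<subseteq> X" "hd xs = x1" "last xs = x2"
    using conn_path[of E X x1 x2] assms unfolding connected_set_def by blast
  obtain ys where ys: "ys \<noteq> []" "distinct ys" "successively E ys" "set ys \<subseteq> X" "hd ys = x3" "last ys = x1"
    using conn_path[of E X x3 x1] assms unfolding connected_set_def by blast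
  have "\<exists>y\<in>set ys. y \<in> set xs" using xs ys by (metis hd_in_set last_in_set)
  then obtain as c bs where s: "ys = as @ c # bs" "c \<in> set xs" "\<forall>a\<in>set as. a \<notin> set xs"
    using split_list_first_prop[of ys "\<lambda>y. y \<in> set xs"] by blast
  then obtain ps qs where p: "xs = ps @ c # qs" by (meson split_list)
  have 1: "successively E (c # qs)" using xs(3) p by (auto simp: successively_append_iff)
  have "successively E (ps @ [c])" using xs(3) p by (auto simp: successively_append_iff)
  then have "successively E (rev (ps @ [c]))" using successively_rev_symp[OF assms(1)] by blast
  then have 2: "successively E (c # rev ps)" by simp
  have "successively E (as @ [c])" using ys(3) s by (auto simp: successively_append_iff)
  then have "successively E (rev (as @ [c]))" using successively_rev_symp[OF assms(1)] by blast
  then have 3: "successively E (c # rev as)" by simp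
  have l1: "last (c # rev ps) = x1" using xs(5) p by (cases ps) auto
  have l3: "last (c # rev as) = x3" using ys(5) s by (cases as) auto
  have l2: "last (c # qs) = x2" using xs(6) p by auto
  show ?thesis
    by (rule exI[of _ c], rule exI[of _ "rev ps"], rule exI[of _ qs], rule exI[of _ "rev as"])
       (use 1 2 3 l1 l2 l3 xs(2,4) ys(2,4) s p in auto)
qed

text \<open>The excluded configuration is a subdivision of K_{2,3} with hubs \<open>u\<close> and
  \<open>v\<close>.\<close>

definition theta_free :: "('a \<Rightarrow> 'a \<Rightarrow> bool) \<Rightarrow> bool" where
  "theta_free E \<longleftrightarrow> \<not> (\<exists>u v P Q R. u \<noteq> v \<and> (\<forall>S\<in>{P, Q, R}. S \<noteq> [] \<and> distinct (u # S @ [v]) \<and> successively E (u # S @ [v])) \<and>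
     set P \<inter> set Q = {} \<and> set P \<inter> set R = {} \<and> set Q \<inter> set R = {})"

lemma theta_freeD:
  assumes "theta_free E" "u \<noteq> v"
    "P \<noteq> [] \<and> distinct (u # P @ [v]) \<and> successively E (u # P @ [v])"
    "Q \<noteq> [] \<and> distinct (u # Q @ [v]) \<and> successively E (u # Q @ [v])"
    "R \<noteq> [] \<and> distinct (u # R @ [v]) \<and> successively E (u # R @ [v])"
    "set P \<inter> set Q = {}" "set P \<inter> set R = {}" "set Q \<inter> set R = {}"
  shows False
  using assms(1) unfolding theta_free_def
  by (rule notE) (intro exI[of _ u] exI[of _ v] exI[of _ P] exI[of _ Q] exI[of _ R], use assms(2-) in auto)

text \<open>A hub of K_{2,3} has degree three, so its branch set can be thinned out to a tripod. The
  centres of both tripods, joined through \<open>A\<close>, \<open>B\<close> and \<open>C\<close>,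
  form a theta.\<close>

lemma K23_minor_free_if_theta_free:
  assumes "symp E" "theta_free E"
  shows "K23_minor_free E"
  unfolding K23_minor_free_def
proof (intro allI impI)
  fix X Y A B C
  assume con: "connected_set E X" "connected_set E Y" "connected_set E A" "connected_set E B" "connected_set E C"
    and dis: "X \<inter> Y = {}" "X \<inter> A = {}" "X \<inter> B = {}" "X \<inter> C = {}" "Y \<inter> A = {}" "Y \<inter> B = {}"
      "Y \<inter> C = {}" "A \<inter> B = {}" "A \<inter> C = {}" "B \<inter> C = {}"
    and t: "touches E X A" "touches E X B" "touches E X C" "touches E Y A" "touches E Y B" "touches E Y C"
  have mid: "\<exists>x y M. x \<in> X \<and> y \<in> Y \<and> M \<noteq> [] \<and> distinct M \<and> successively E M \<and> set M \<subseteq> A \<and> E x (hd M) \<and> E (last M) y"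
    if cA: "connected_set E A" and tA: "touches E X A" "touches E Y A" for A
  proof -
    obtain x a y a' where h: "x \<in> X" "a \<in> A" "E x a" "y \<in> Y" "a' \<in> A" "E y a'"
      using tA unfolding touches_def by blast
    obtain M where "M \<noteq> []" "distinct M" "successively E M" "set M \<subseteq> A" "hd M = a" "last M = a'"
      using conn_path[of E A a a'] cA h unfolding connected_set_def by blast
    then show ?thesis using h sympD[OF assms(1)] by blast
  qed
  obtain x1 y1 M1 where M1: "x1 \<in> X" "y1 \<in> Y" "M1 \<noteq> []" "distinct M1" "successively E M1" "set M1 \<subseteq> A" "E x1 (hd M1)" "E (last M1) y1"
    using mid[OF con(3) t(1,4)] by blast
  obtain x2 y2 M2 where M2: "x2 \<in> X" "y2 \<in> Y" "M2 \<noteq> []" "distinct M2" "successively E M2" "set M2 \<subseteq> B" "E x2 (hd M2)" "E (last M2) y2"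
    using mid[OF con(4) t(2,5)] by blast
  obtain x3 y3 M3 where M3: "x3 \<in> X" "y3 \<in> Y" "M3 \<noteq> []" "distinct M3" "successively E M3" "set M3 \<subseteq> C" "E x3 (hd M3)" "E (last M3) y3"
    using mid[OF con(5) t(3,6)] by blast
  obtain u P1 P2 P3 where P: "\<forall>(S, x) \<in> {(P1, x1), (P2, x2), (P3, x3)}. distinct (u # S) \<and> successively E (u # S) \<and>
      set (u # S) \<subseteq> X \<and> last (u # S) = x" "set P1 \<inter> set P2 = {}" "set P1 \<inter> set P3 = {}" "set P2 \<inter> set P3 = {}"
    using connected_set_tripod[OF assms(1) con(1) M1(1) M2(1) M3(1)] by blast
  obtain v Q1 Q2 Q3 where Q: "\<forall>(S, x) \<in> {(Q1, y1), (Q2, y2), (Q3, y3)}. distinct (v # S) \<and> successively E (v # S) \<and>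
      set (v # S) \<subseteq> Y \<and> last (v # S) = x" "set Q1 \<inter> set Q2 = {}" "set Q1 \<inter> set Q3 = {}" "set Q2 \<inter> set Q3 = {}"
    using connected_set_tripod[OF assms(1) con(2) M1(2) M2(2) M3(2)] by blast
  have path: "P @ M @ rev Q \<noteq> [] \<and> distinct (u # (P @ M @ rev Q) @ [v]) \<and> successively E (u # (P @ M @ rev Q) @ [v])"
    if "distinct (u # P)" "successively E (u # P)" "set (u # P) \<subseteq> X" "last (u # P) = x"
      "distinct (v # Q)" "successively E (v # Q)" "set (v # Q) \<subseteq> Y" "last (v # Q) = y"
      "M \<noteq> []" "distinct M" "successively E M" "set M \<subseteq> A" "E x (hd M)" "E (last M) y"
      "X \<inter> A = {}" "Y \<inter> A = {}" for P Q M x y A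
  proof -
    have r: "successively E (rev (v # Q))" using successively_rev_symp[OF assms(1)] that(6) by blast
    have "hd (rev (v # Q)) = y" using that(8) by (simp only: hd_rev)
    then have "successively E ((u # P) @ M @ rev (v # Q))"
      using that(2,4,9,11,13,14) r unfolding successively_append_iff by auto
    moreover have "distinct ((u # P) @ M @ rev (v # Q))" using that dis(1) by auto
    ultimately show ?thesis using that(9) by simp
  qed
  have disj: "set (p @ m @ rev q) \<inter> set (p' @ m' @ rev q') = {}"
    if "set p \<subseteq> X" "set p' \<subseteq> X" "set q \<subseteq> Y" "set q' \<subseteq> Y" "set m \<subseteq> A" "set m' \<subseteq> B"
      "set p \<inter> set p' = {}" "set q \<inter> set q' = {}"
      "X \<inter> A = {}" "X \<inter> B = {}" "Y \<inter> A = {}" "Y \<inter> B = {}" "A \<inter> B = {}" for p p' q q' m m' A B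
  proof -
    have "set p \<inter> set m' = {}" "set p \<inter> set q' = {}" using that(1,4,6,10) dis(1) by blast+
    moreover have "set m \<inter> set p' = {}" "set m \<inter> set m' = {}" using that(2,5,6,9,13) by blast+
    moreover have "set m \<inter> set q' = {}" "set q \<inter> set m' = {}" using that(3,4,5,6,11,12) by blast+
    moreover have "set q \<inter> set p' = {}" using that(2,3) dis(1) by blast
    ultimately show ?thesis using that(7,8) by (simp add: Int_Un_distrib Int_Un_distrib2)
  qed
  have PX: "set P1 \<subseteq> X" "set P2 \<subseteq> X" "set P3 \<subseteq> X" "u \<in> X" using P(1) by auto
  have QY: "set Q1 \<subseteq> Y" "set Q2 \<subseteq> Y" "set Q3 \<subseteq> Y" "v \<in> Y" using Q(1) by auto
  show False
  proof (rule theta_freeD[OF assms(2)])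
    show "u \<noteq> v" using PX QY dis by blast
    show "P1 @ M1 @ rev Q1 \<noteq> [] \<and> distinct (u # (P1 @ M1 @ rev Q1) @ [v]) \<and> successively E (u # (P1 @ M1 @ rev Q1) @ [v])"
      by (rule path[of _ x1 _ y1 _ A]) (use P(1) Q(1) M1 dis in simp_all)
    show "P2 @ M2 @ rev Q2 \<noteq> [] \<and> distinct (u # (P2 @ M2 @ rev Q2) @ [v]) \<and> successively E (u # (P2 @ M2 @ rev Q2) @ [v])"
      by (rule path[of _ x2 _ y2 _ B]) (use P(1) Q(1) M2 dis in simp_all)
    show "P3 @ M3 @ rev Q3 \<noteq> [] \<and> distinct (u # (P3 @ M3 @ rev Q3) @ [v]) \<and> successively E (u # (P3 @ M3 @ rev Q3) @ [v])"
      by (rule path[of _ x3 _ y3 _ C]) (use P(1) Q(1) M3 dis in simp_all)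
    show "set (P1 @ M1 @ rev Q1) \<inter> set (P2 @ M2 @ rev Q2) = {}"
      by (rule disj[OF PX(1,2) QY(1,2) M1(6) M2(6) P(2) Q(2) dis(2,3,5,6,8)])
    show "set (P1 @ M1 @ rev Q1) \<inter> set (P3 @ M3 @ rev Q3) = {}"
      by (rule disj[OF PX(1,3) QY(1,3) M1(6) M3(6) P(3) Q(3) dis(2,4,5,7,9)])
    show "set (P2 @ M2 @ rev Q2) \<inter> set (P3 @ M3 @ rev Q3) = {}"
      by (rule disj[OF PX(2,3) QY(2,3) M2(6) M3(6) P(4) Q(4) dis(3,4,6,7,10)])
  qed
qed

section \<open>Plane embeddings\<close>

definition list_edges :: "'a list \<Rightarrow> ('a \<times> 'a) set" where
  "list_edges xs = set (zip xs (tl xs))"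

lemma list_edges_simps [simp]:
  "list_edges [] = {}" "list_edges [x] = {}" "list_edges (x # y # xs) = insert (x, y) (list_edges (y # xs))"
  by (auto simp: list_edges_def)

lemma list_edges_in: "e \<in> list_edges xs \<Longrightarrow> fst e \<in> set xs \<and> snd e \<in> set xs"
  by (induction xs rule: induct_list012) auto

lemma list_edges_succ: "successively E xs \<Longrightarrow> (x, y) \<in> list_edges xs \<Longrightarrow> E x y"
  by (induction xs rule: induct_list012) auto

lemma list_edges_append: "xs \<noteq> [] \<Longrightarrow> list_edges (xs @ [v]) = insert (last xs, v) (list_edges xs)"
  by (induction xs rule: induct_list012) auto

lemma in_list_edge: "w \<in> set xs \<Longrightarrow> length xs \<ge> 2 \<Longrightarrow> \<exists>e\<in>list_edges xs. w = fst e \<or> w = snd e"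
proof (induction xs rule: induct_list012)
  case (3 x y zs)
  then show ?case by (cases zs) auto
qed auto

locale embedded_graph =
  fixes G :: "'a pair_pre_digraph" and pos \<gamma>
  assumes G: "pair_graph G" and emb: "plane_embedding G pos \<gamma>"
begin

definition adj :: "'a \<Rightarrow> 'a \<Rightarrow> bool" where "adj x y \<longleftrightarrow> (x, y) \<in> parcs G"

lemma adj_sym: "adj x y \<Longrightarrow> adj y x"
proof -
  interpret pair_graph G by (rule G)
  show "adj x y \<Longrightarrow> adj y x" using pair_sym_arcs unfolding adj_def symmetric_def sym_def
    by (metis arcs_symmetric)
qed

lemma adj_verts: "adj x y \<Longrightarrow> x \<in> pverts G \<and> y \<in> pverts G"
proof -
  interpret pair_graph G by (rule G)
  show "adj x y \<Longrightarrow> x \<in> pverts G \<and> y \<in> pverts G"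
    unfolding adj_def using arc_fst_in_verts arc_snd_in_verts by force
qed

lemma adj_irrefl: "\<not> adj x x"
proof -
  interpret pair_graph G by (rule G)
  show ?thesis unfolding adj_def using pair_no_loops by force
qed

lemma inj_pos: "inj_on pos (pverts G)"
  using emb unfolding plane_embedding_def by blast

lemma edge_arc:
  assumes "adj u v"
  shows "arc (\<gamma> (u, v))" "pathstart (\<gamma> (u, v)) = pos u" "pathfinish (\<gamma> (u, v)) = pos v"
    "path_image (\<gamma> (u, v)) \<inter> pos ` pverts G = {pos u, pos v}" "\<gamma> (v, u) = reversepath (\<gamma> (u, v))"
proof -
  have *: "\<forall>(u, v) \<in> parcs G.
        arc (\<gamma> (u, v)) \<and> pathstart (\<gamma> (u, v)) = pos u \<and> pathfinish (\<gamma> (u, v)) = pos v \<and>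
        \<gamma> (v, u) = reversepath (\<gamma> (u, v)) \<and>
        path_image (\<gamma> (u, v)) \<inter> pos ` pverts G = {pos u, pos v}"
    using emb unfolding plane_embedding_def by blast
  from bspec[OF *, of "(u, v)", unfolded prod.case] assms
  show "arc (\<gamma> (u, v))" "pathstart (\<gamma> (u, v)) = pos u" "pathfinish (\<gamma> (u, v)) = pos v"
    "path_image (\<gamma> (u, v)) \<inter> pos ` pverts G = {pos u, pos v}" "\<gamma> (v, u) = reversepath (\<gamma> (u, v))"
    unfolding adj_def by blast+
qed

lemma edge_inter:
  assumes "adj u v" "adj x y" "{u, v} \<noteq> {x, y}"
  shows "path_image (\<gamma> (u, v)) \<inter> path_image (\<gamma> (x, y)) \<subseteq> pos ` ({u, v} \<inter> {x, y})"
proof -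
  have *: "\<forall>(u, v) \<in> parcs G. \<forall>(x, y) \<in> parcs G. {u, v} \<noteq> {x, y} \<longrightarrow>
        path_image (\<gamma> (u, v)) \<inter> path_image (\<gamma> (x, y)) \<subseteq> pos ` ({u, v} \<inter> {x, y})"
    using emb unfolding plane_embedding_def by blast
  from bspec[OF bspec[OF *, of "(u, v)", unfolded prod.case], of "(x, y)"] show ?thesis
    using assms unfolding adj_def by simp
qed

definition trace :: "'a list \<Rightarrow> complex set" where
  "trace xs = (\<Union>e\<in>list_edges xs. path_image (\<gamma> e))"

lemma trace_simps: "trace [x, y] = path_image (\<gamma> (x, y))"
  "trace (x # y # z # zs) = path_image (\<gamma> (x, y)) \<union> trace (y # z # zs)"
  by (auto simp: trace_def)

lemma trace_subset: "successively adj xs \<Longrightarrow> trace xs \<subseteq> drawing G pos \<gamma>"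
  unfolding trace_def drawing_def using list_edges_succ[of adj xs] by (auto simp: adj_def)

lemma pos_in_trace:
  assumes "successively adj xs" "w \<in> set xs" "length xs \<ge> 2" shows "pos w \<in> trace xs"
proof -
  obtain x y where e: "(x, y) \<in> list_edges xs" "w = x \<or> w = y" using in_list_edge[OF assms(2,3)] by force
  have a: "adj x y" using list_edges_succ[OF assms(1) e(1)] .
  have "pos w \<in> path_image (\<gamma> (x, y))"
    using e(2) edge_arc(2,3)[OF a] pathstart_in_path_image[of "\<gamma> (x, y)"] pathfinish_in_path_image[of "\<gamma> (x, y)"] by auto
  then show ?thesis unfolding trace_def using e(1) by blast
qed

lemma pos_notin_trace:
  assumes "successively adj xs" "w \<notin> set xs" "w \<in> pverts G" shows "pos w \<notin> trace xs"
proof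
  assume "pos w \<in> trace xs"
  then obtain x y where e: "(x, y) \<in> list_edges xs" "pos w \<in> path_image (\<gamma> (x, y))" unfolding trace_def by force
  have a: "adj x y" using list_edges_succ[OF assms(1) e(1)] .
  then have "pos w = pos x \<or> pos w = pos y" using edge_arc(4)[OF a] e(2) assms(3) by blast
  then have "w = x \<or> w = y" using inj_pos assms(3) adj_verts[OF a] by (auto simp: inj_on_eq_iff)
  then show False using list_edges_in[OF e(1)] assms(2) by auto
qed

text \<open>The last hypothesis rules out a common edge in either orientation; distinct edges meet
  only in common vertices.\<close>

lemma trace_inter:
  assumes "successively adj xs" "successively adj ys"
    "\<And>e. e \<in> list_edges xs \<Longrightarrow> fst e \<notin> set ys \<or> snd e \<notin> set ys"
  shows "trace xs \<inter> trace ys \<subseteq> pos ` (set xs \<inter> set ys)"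
proof
  fix z assume "z \<in> trace xs \<inter> trace ys"
  then obtain u v x y where e: "(u, v) \<in> list_edges xs" "z \<in> path_image (\<gamma> (u, v))"
     "(x, y) \<in> list_edges ys" "z \<in> path_image (\<gamma> (x, y))" unfolding trace_def by force
  have a: "adj u v" "adj x y" using list_edges_succ e(1,3) assms(1,2) by metis+
  have i: "u \<in> set xs" "v \<in> set xs" "x \<in> set ys" "y \<in> set ys" using list_edges_in[OF e(1)] list_edges_in[OF e(3)] by auto
  have "{u, v} \<noteq> {x, y}" using assms(3)[OF e(1)] i by (auto simp: doubleton_eq_iff)
  from edge_inter[OF a this] e have "z \<in> pos ` ({u, v} \<inter> {x, y})" by blast
  then show "z \<in> pos ` (set xs \<inter> set ys)" using i by auto
qed

lemma trace_arc:
  assumes "distinct xs" "successively adj xs" "length xs \<ge> 2"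
  shows "\<exists>g. arc g \<and> pathstart g = pos (hd xs) \<and> pathfinish g = pos (last xs) \<and> path_image g = trace xs"
  using assms
proof (induction xs rule: induct_list012)
  case (3 x y zs)
  have a: "adj x y" using "3.prems" by simp
  show ?case
  proof (cases zs)
    case Nil
    then show ?thesis using edge_arc[OF a] by (intro exI[of _ "\<gamma> (x, y)"]) (auto simp: trace_simps)
  next
    case (Cons z zs')
    then obtain g where g: "arc g" "pathstart g = pos y" "pathfinish g = pos (last (y # zs))" "path_image g = trace (y # zs)"
      using "3.IH"(2) "3.prems" by auto
    have "trace [x, y] \<inter> trace (y # zs) \<subseteq> pos ` (set [x, y] \<inter> set (y # zs))"
      by (rule trace_inter) (use "3.prems" in auto)
    also have "\<dots> \<subseteq> {pos y}" using "3.prems"(1) by auto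
    finally have "path_image (\<gamma> (x, y)) \<inter> path_image g \<subseteq> {pathstart g}" using g by (simp add: trace_simps)
    then have "arc (\<gamma> (x, y) +++ g)" using edge_arc[OF a] g by (intro arc_join) auto
    then show ?thesis using edge_arc[OF a] g Cons
      by (intro exI[of _ "\<gamma> (x, y) +++ g"]) (auto simp: path_image_join trace_simps)
  qed
qed auto

text \<open>Since \<open>P\<close> is nonempty, every edge of the first path has an end in
  \<open>P\<close>, off the second path. The second path may be a single edge.\<close>

lemma trace_inter_ends:
  assumes "distinct (u # P @ [v])" "successively adj (u # P @ [v])" "P \<noteq> []"
    "distinct (u # Q @ [v])" "successively adj (u # Q @ [v])" "set P \<inter> set Q = {}"
  shows "trace (u # P @ [v]) \<inter> trace (u # Q @ [v]) = {pos u, pos v}"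
proof
  have "trace (u # P @ [v]) \<inter> trace (u # Q @ [v]) \<subseteq> pos ` (set (u # P @ [v]) \<inter> set (u # Q @ [v]))"
  proof (rule trace_inter[OF assms(2,5)])
    fix e assume e: "e \<in> list_edges (u # P @ [v])"
    obtain p P' where P: "P = p # P'" using assms(3) by (cases P) auto
    have "list_edges (u # P @ [v]) = insert (u, p) (insert (last P, v) (list_edges P))"
      using list_edges_append[OF assms(3)] P by simp
    then have "e = (u, p) \<or> e = (last P, v) \<or> e \<in> list_edges P" using e by blast
    moreover have "p \<in> set P" "last P \<in> set P" using P assms(3) by auto
    ultimately have "fst e \<in> set P \<or> snd e \<in> set P" using list_edges_in[of e P] by force
    then show "fst e \<notin> set (u # Q @ [v]) \<or> snd e \<notin> set (u # Q @ [v])" using assms(1,6) by auto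
  qed
  also have "\<dots> \<subseteq> {pos u, pos v}" using assms(6) by auto
  finally show "trace (u # P @ [v]) \<inter> trace (u # Q @ [v]) \<subseteq> {pos u, pos v}" .
  show "{pos u, pos v} \<subseteq> trace (u # P @ [v]) \<inter> trace (u # Q @ [v])"
    using pos_in_trace[OF assms(2)] pos_in_trace[OF assms(5)] by auto
qed

end

section \<open>Consequences of all vertices lying on the outer face\<close>

locale outerplane_graph = embedded_graph +
  assumes outer: "pos ` pverts G \<subseteq> frontier (outside (drawing G pos \<gamma>))"
begin

text \<open>An open inside containing a vertex would meet the outer face, which lies outside every
  part \<open>K\<close> of the drawing.\<close>

lemma vertex_not_inside:
  assumes "w \<in> pverts G" "K \<subseteq> drawing G pos \<gamma>" "open (inside K)"
  shows "pos w \<notin> inside K"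
proof
  assume "pos w \<in> inside K"
  moreover have "pos w \<in> closure (outside (drawing G pos \<gamma>))" using outer assms(1) unfolding frontier_def by blast
  ultimately have "inside K \<inter> outside (drawing G pos \<gamma>) \<noteq> {}"
    using assms(3) by (metis disjoint_iff open_Int_closure_eq_empty)
  then show False using outside_mono[OF assms(2)] inside_Int_outside[of K] by blast
qed

text \<open>The paths through \<open>P\<close> and \<open>Q\<close> contain inner vertices, which
  cannot be enclosed, so the third path is. It may be a bare edge, as needed for
  \<open>K4_free\<close>.\<close>

lemma theta_chord:
  assumes ne: "u \<noteq> v"
    and P: "distinct (u # P @ [v])" "successively adj (u # P @ [v])" "P \<noteq> []"
    and Q: "distinct (u # Q @ [v])" "successively adj (u # Q @ [v])" "Q \<noteq> []"
    and R: "distinct (u # R @ [v])" "successively adj (u # R @ [v])"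
    and dis: "set P \<inter> set Q = {}" "set P \<inter> set R = {}" "set Q \<inter> set R = {}"
  obtains c1 c2 c3 where "arc c1" "arc c2" "arc c3"
    "pathstart c1 = pos u" "pathfinish c1 = pos v" "pathstart c2 = pos u" "pathfinish c2 = pos v"
    "pathstart c3 = pos u" "pathfinish c3 = pos v"
    "path_image c1 = trace (u # P @ [v])" "path_image c2 = trace (u # Q @ [v])" "path_image c3 = trace (u # R @ [v])"
    "path_image c1 \<inter> path_image c2 = {pos u, pos v}" "path_image c1 \<inter> path_image c3 = {pos u, pos v}"
    "path_image c2 \<inter> path_image c3 = {pos u, pos v}"
    "path_image c3 - {pos u, pos v} \<subseteq> inside (path_image c1 \<union> path_image c2)"
    "path_image c3 \<inter> inside (path_image c1 \<union> path_image c2) \<noteq> {}"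
proof -
  obtain c1 where c1: "arc c1" "pathstart c1 = pos u" "pathfinish c1 = pos v" "path_image c1 = trace (u # P @ [v])"
    using trace_arc[OF P(1,2)] by auto
  obtain c2 where c2: "arc c2" "pathstart c2 = pos u" "pathfinish c2 = pos v" "path_image c2 = trace (u # Q @ [v])"
    using trace_arc[OF Q(1,2)] by auto
  obtain c3 where c3: "arc c3" "pathstart c3 = pos u" "pathfinish c3 = pos v" "path_image c3 = trace (u # R @ [v])"
    using trace_arc[OF R(1,2)] by auto
  have i: "path_image c1 \<inter> path_image c2 = {pos u, pos v}" "path_image c1 \<inter> path_image c3 = {pos u, pos v}"
    "path_image c2 \<inter> path_image c3 = {pos u, pos v}"
    unfolding c1(4) c2(4) c3(4)
    using trace_inter_ends[OF P Q(1,2) dis(1)] trace_inter_ends[OF P R dis(2)] trace_inter_ends[OF Q R dis(3)] by auto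
  have sub: "path_image c1 \<subseteq> drawing G pos \<gamma>" "path_image c2 \<subseteq> drawing G pos \<gamma>" "path_image c3 \<subseteq> drawing G pos \<gamma>"
    unfolding c1(4) c2(4) c3(4) using trace_subset P(2) Q(2) R(2) by blast+
  have vert: "x \<in> pverts G" if x: "x \<in> set (u # L @ [v])" and L: "successively adj (u # L @ [v])" for x L
  proof -
    obtain e where "e \<in> list_edges (u # L @ [v])" "x = fst e \<or> x = snd e" using in_list_edge[OF x] by auto
    then show ?thesis using list_edges_succ[OF L, of "fst e" "snd e"] adj_verts by auto
  qed
  have inner: "pos (hd L) \<in> trace (u # L @ [v]) - {pos u, pos v}" "hd L \<in> pverts G"
    if "L \<noteq> []" "distinct (u # L @ [v])" "successively adj (u # L @ [v])" for L
  proof -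
    show h: "hd L \<in> pverts G" using vert[of "hd L" L] that by simp
    have "u \<in> pverts G" "v \<in> pverts G" using vert[of _ L] that by auto
    moreover have "hd L \<noteq> u" "hd L \<noteq> v" using that(1,2) hd_in_set[OF that(1)] by auto
    ultimately have "pos (hd L) \<noteq> pos u" "pos (hd L) \<noteq> pos v" using inj_pos h by (auto simp: inj_on_eq_iff)
    moreover have "pos (hd L) \<in> trace (u # L @ [v])" using that by (intro pos_in_trace) auto
    ultimately show "pos (hd L) \<in> trace (u # L @ [v]) - {pos u, pos v}" by blast
  qed
  note w1 = inner[OF P(3,1,2)] and w2 = inner[OF Q(3,1,2)]
  have o1: "pos (hd P) \<notin> inside (path_image c2 \<union> path_image c3)"
    by (rule vertex_not_inside[OF w1(2)]) (use sub Jordan_two_arcs(4)[OF c2(1) c3(1) c2(2,3) c3(2,3) i(3)] in auto)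
  have o2: "pos (hd Q) \<notin> inside (path_image c1 \<union> path_image c3)"
    by (rule vertex_not_inside[OF w2(2)]) (use sub Jordan_two_arcs(4)[OF c1(1) c3(1) c1(2,3) c3(2,3) i(2)] in auto)
  note th = theta_third_inside[OF c1(1) c2(1) c3(1) c1(2,3) c2(2,3) c3(2,3) i w1(1)[folded c1(4)] o1 w2(1)[folded c2(4)] o2]
  show thesis
    using that[OF c1(1) c2(1) c3(1) c1(2,3) c2(2,3) c3(2,3) c1(4) c2(4) c3(4) i th] .
qed

lemma theta_free: "theta_free adj"
  unfolding theta_free_def
proof (rule notI, elim exE conjE)
  fix u v P Q R
  assume ne: "u \<noteq> v" and L: "\<forall>S\<in>{P, Q, R}. S \<noteq> [] \<and> distinct (u # S @ [v]) \<and> successively adj (u # S @ [v])"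
    and dis: "set P \<inter> set Q = {}" "set P \<inter> set R = {}" "set Q \<inter> set R = {}"
  have P: "distinct (u # P @ [v])" "successively adj (u # P @ [v])" "P \<noteq> []"
    and Q: "distinct (u # Q @ [v])" "successively adj (u # Q @ [v])" "Q \<noteq> []"
    and R: "distinct (u # R @ [v])" "successively adj (u # R @ [v])" "R \<noteq> []" using L by simp_all
  obtain c1 c2 c3 where c: "arc c1" "arc c2" 
    "pathstart c1 = pos u" "pathfinish c1 = pos v" "pathstart c2 = pos u" "pathfinish c2 = pos v"
    "path_image c1 = trace (u # P @ [v])" "path_image c2 = trace (u # Q @ [v])" "path_image c3 = trace (u # R @ [v])"
    "path_image c1 \<inter> path_image c2 = {pos u, pos v}"
    "path_image c3 - {pos u, pos v} \<subseteq> inside (path_image c1 \<union> path_image c2)"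
    by (rule theta_chord[OF ne P Q R(1,2) dis])
  have "pos (hd R) \<in> trace (u # R @ [v])" using R by (intro pos_in_trace) auto
  moreover have e: "adj u (hd R)" using R by (cases R) auto
  then have V: "u \<in> pverts G" "hd R \<in> pverts G" using adj_verts by blast+
  have "adj (last R) v" using R(2,3) by (simp add: successively_append_iff successively_Cons split: if_splits)
  then have "v \<in> pverts G" using adj_verts by blast
  moreover have "hd R \<noteq> u" "hd R \<noteq> v" using R(1) hd_in_set[OF R(3)] by auto
  ultimately have "pos (hd R) \<in> path_image c3 - {pos u, pos v}"
    unfolding c(9) using V inj_pos by (auto simp: inj_on_eq_iff)
  then have "pos (hd R) \<in> inside (path_image c1 \<union> path_image c2)" using c(11) by blast
  moreover have "path_image c1 \<union> path_image c2 \<subseteq> drawing G pos \<gamma>"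
    unfolding c(7,8) using trace_subset P(2) Q(2) by blast
  ultimately show False
    using vertex_not_inside[OF V(2)] Jordan_two_arcs(4)[OF c(1-6,10)] by blast
qed

text \<open>Both diagonals \<open>ac\<close> and \<open>bd\<close> of the cycle \<open>abcd\<close>
  run inside it. The first splits the inside into two regions, and the second stays in one of them;
  but \<open>b\<close> and \<open>d\<close> lie on the boundaries of different regions.\<close>

lemma K4_free: "K4_free adj"
  unfolding K4_free_def
proof (rule notI, elim exE conjE)
  fix a b c d
  assume E: "adj a b" "adj a c" "adj a d" "adj b c" "adj b d" "adj c d"
  note E' = E E[THEN adj_sym]
  have ne: "a \<noteq> b" "a \<noteq> c" "a \<noteq> d" "b \<noteq> c" "b \<noteq> d" "c \<noteq> d" using E adj_irrefl by blast+
  have V: "a \<in> pverts G" "b \<in> pverts G" "c \<in> pverts G" "d \<in> pverts G" using E adj_verts by blast+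
  obtain p q r where pqr: "arc p" "arc q" "arc r"
    "pathstart p = pos a" "pathfinish p = pos c" "pathstart q = pos a" "pathfinish q = pos c"
    "pathstart r = pos a" "pathfinish r = pos c"
    "path_image p = trace (a # [b] @ [c])" "path_image q = trace (a # [d] @ [c])" "path_image r = trace (a # [] @ [c])"
    "path_image p \<inter> path_image q = {pos a, pos c}" "path_image p \<inter> path_image r = {pos a, pos c}"
    "path_image q \<inter> path_image r = {pos a, pos c}"
    "path_image r - {pos a, pos c} \<subseteq> inside (path_image p \<union> path_image q)"
    "path_image r \<inter> inside (path_image p \<union> path_image q) \<noteq> {}"
    by (rule theta_chord[of a c "[b]" "[d]" "[]"]) (use E' ne in auto)
  obtain p' q' r' where pqr': "arc r'" "pathstart r' = pos b" "pathfinish r' = pos d"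
    "path_image p' = trace (b # [a] @ [d])" "path_image q' = trace (b # [c] @ [d])" "path_image r' = trace (b # [] @ [d])"
    "path_image r' - {pos b, pos d} \<subseteq> inside (path_image p' \<union> path_image q')"
    by (rule theta_chord[of b d "[a]" "[c]" "[]"]) (use E' ne in auto)
  have rev: "path_image (\<gamma> (y, x)) = path_image (\<gamma> (x, y))" if "adj x y" for x y
    using edge_arc(5)[OF that] by simp
  have same: "path_image p' \<union> path_image q' = path_image p \<union> path_image q"
    unfolding pqr(10,11) pqr'(4,5) using rev[OF E(1)] rev[OF E(6)] rev[OF E(3)] rev[OF E(4)]
    by (auto simp: trace_simps)
  let ?I1 = "inside (path_image p \<union> path_image r)" and ?I2 = "inside (path_image q \<union> path_image r)"
  have ac: "pos a \<noteq> pos c" using V ne inj_pos by (auto simp: inj_on_eq_iff)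
  have split: "?I1 \<inter> ?I2 = {}" "?I1 \<union> ?I2 \<union> (path_image r - {pos a, pos c}) = inside (path_image p \<union> path_image q)"
    by (rule split_inside_simple_closed_curve[OF arc_imp_simple_path[OF pqr(1)] pqr(4,5)
          arc_imp_simple_path[OF pqr(2)] pqr(6,7) arc_imp_simple_path[OF pqr(3)] pqr(8,9) ac pqr(13-15,17)],
        assumption)+
  note J1 = Jordan_two_arcs[OF pqr(1,3) pqr(4,5) pqr(8,9) pqr(14)]
  note J2 = Jordan_two_arcs[OF pqr(2,3) pqr(6,7) pqr(8,9) pqr(15)]
  let ?T = "path_image r' - {pos b, pos d}"
  have "trace [b, d] \<inter> trace [a, c] \<subseteq> pos ` (set [b, d] \<inter> set [a, c])"
    by (rule trace_inter) (use E' ne in auto)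
  then have "path_image r' \<inter> path_image r = {}" unfolding pqr'(6) pqr(12) using ne by auto
  then have T: "?T \<subseteq> ?I1 \<union> ?I2" using pqr'(7) split(2) unfolding same by blast
  have "connected ?T" using connected_simple_path_endless[OF arc_imp_simple_path[OF pqr'(1)]] pqr'(2,3) by simp
  then have "?T \<subseteq> ?I1 \<or> ?T \<subseteq> ?I2"
    using connectedD[OF _ J1(4) J2(4) _ T] split(1) T by blast
  moreover have closure_T: "path_image r' \<subseteq> closure S" if "?T \<subseteq> S" for S
  proof -
    have cont: "continuous_on {0..1} r'" using pqr'(1) arc_imp_path path_def by blast
    have "r' ` {0<..<1} \<subseteq> ?T"
    proof
      fix z assume "z \<in> r' ` {0<..<1}"
      then obtain t where t: "0 < t" "t < 1" "z = r' t" by auto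
      have "r' t \<noteq> r' 0" "r' t \<noteq> r' 1" using pqr'(1) t unfolding arc_def inj_on_def by force+
      then show "z \<in> ?T" using t pqr'(2,3) unfolding pathstart_def pathfinish_def path_image_def by auto
    qed
    then have "r' ` {0<..<1} \<subseteq> closure S" using that closure_subset by blast
    then have "r' ` closure {0<..<1} \<subseteq> closure S"
      by (intro image_closure_subset) (use cont in auto)
    then show ?thesis unfolding path_image_def by simp
  qed
  \<comment> \<open>Here \<open>w\<close> is the end of \<open>bd\<close> off the boundary of the
    region: it lies in the closure, but neither on the frontier nor inside.\<close>
  moreover have False if "path_image r' \<subseteq> closure (inside (path_image x \<union> path_image r))"
    "frontier (inside (path_image x \<union> path_image r)) = path_image x \<union> path_image r"
    "open (inside (path_image x \<union> path_image r))"
    "path_image x = trace [a, y, c]" "w \<in> {b, d}" "y \<in> {b, d}" "w \<noteq> y" for x y w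
  proof -
    have wV: "w \<in> pverts G" using that(5) V by auto
    have s: "successively adj [a, y, c]" using that(6) E' by auto
    have "pos w \<in> closure (inside (path_image x \<union> path_image r))"
      using that(1,5) pqr'(2,3) pathstart_in_path_image[of r'] pathfinish_in_path_image[of r'] by auto
    moreover have "path_image x \<union> path_image r \<subseteq> drawing G pos \<gamma>"
      using trace_subset[OF s] trace_subset[of "[a, c]"] E' pqr(12) that(4) by auto
    then have "pos w \<notin> inside (path_image x \<union> path_image r)" using vertex_not_inside[OF wV _ that(3)] by blast
    ultimately have "pos w \<in> path_image x \<union> path_image r"
      using that(2) closure_Un_frontier[of "inside (path_image x \<union> path_image r)"] by blast
    moreover have "pos w \<notin> path_image x" unfolding that(4)
      by (rule pos_notin_trace[OF s _ wV]) (use that(5-7) ne in auto)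
    moreover have "pos w \<notin> path_image r" unfolding pqr(12)
      by (rule pos_notin_trace[OF _ _ wV]) (use that(5-7) ne E' in auto)
    ultimately show False by blast
  qed
  ultimately show False
    using J1(8,4) J2(8,4) pqr(10,11) ne by (metis append_Cons append_Nil insertI1 insertI2)
qed

end

section \<open>Translation to the given graph notions and conclusion\<close>

lemma path_avoiding_nbhd_if_misses:
  assumes "misses (\<lambda>x y. (x, y) \<in> parcs G) (pverts G) a b c"
  shows "path_avoiding_nbhd G a b c"
proof -
  let ?E = "\<lambda>x y. (x, y) \<in> parcs G"
  obtain xs where xs: "xs \<noteq> []" "distinct xs" "successively ?E xs"
    "set xs \<subseteq> pverts G - nbhd ?E c" "hd xs = a" "last xs = b"
    using conn_path[OF assms[unfolded misses_def]] by blast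
  have "set (vwalk_arcs xs) \<subseteq> parcs G"
    using xs(3) by (induction xs rule: vwalk_arcs.induct) auto
  then have "vpath xs (with_proj G)"
    using xs(1,2,4) by (auto simp: vpath_def vwalk_def arcs_ends_def arc_to_ends_def)
  moreover have "closed_nbhd G c = nbhd ?E c" by (simp add: closed_nbhd_def nbhd_def)
  ultimately show ?thesis using xs(4-6) unfolding path_avoiding_nbhd_def by blast
qed

lemma no_has_AT_if_AT_free:
  assumes "AT_free G"
  shows "\<not> has_AT (\<lambda>x y. (x, y) \<in> parcs G) (pverts G)"
proof
  let ?E = "\<lambda>x y. (x, y) \<in> parcs G"
  assume "has_AT ?E (pverts G)"
  then obtain a b c where V: "a \<in> pverts G" "b \<in> pverts G" "c \<in> pverts G"
    and m: "misses ?E (pverts G) a b c" "misses ?E (pverts G) b c a" "misses ?E (pverts G) a c b"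
    unfolding has_AT_def by blast
  have "a \<notin> nbhd ?E b" "c \<notin> nbhd ?E b" "b \<notin> nbhd ?E c" "a \<notin> nbhd ?E c" "b \<notin> nbhd ?E a" "c \<notin> nbhd ?E a"
    using m misses_in(3,4) by metis+
  then have "asteroidal_triple G a b c"
    unfolding asteroidal_triple_def using V m[THEN path_avoiding_nbhd_if_misses]
    by (auto simp: nbhd_def)
  then show False using assms unfolding AT_free_def by blast
qed

theorem theorem3:
  fixes G :: "'a pair_pre_digraph"
  assumes "pair_graph G"
    and "AT_free G"
    and "outerplanar G"
  shows "B0_VPG G"
proof (cases "pverts G = {}")
  case True
  then show ?thesis by (simp add: B0_VPG_def)
next
  case False
  obtain pos \<gamma> where "plane_embedding G pos \<gamma>"
    "pos ` pverts G \<subseteq> frontier (outside (drawing G pos \<gamma>))"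
    using assms(3) unfolding outerplanar_def by blast
  then interpret outerplane_graph G pos \<gamma>
    using assms(1)
    by (intro outerplane_graph.intro embedded_graph.intro outerplane_graph_axioms.intro)
  have adj: "adj = (\<lambda>x y. (x, y) \<in> parcs G)" by (auto simp: adj_def fun_eq_iff)
  have symp: "symp adj" using adj_sym by (rule sympI)
  interpret K23_K4_free adj
    by unfold_locales
      (fact symp adj_irrefl K23_minor_free_if_theta_free[OF symp theta_free] K4_free)+
  have fin: "finite (pverts G)" using assms(1)
    by (simp add: pair_graph_def pair_digraph_def pair_fin_digraph_def pair_fin_digraph_axioms_def)
  obtain s where "s \<in> pverts G" "layout adj (pverts G - {s}) (Some s) None"
    using ex_start_layout[OF fin False] no_has_AT_if_AT_free[OF assms(2)] unfolding adj by blast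
  then obtain l r d u where "box_rep (lift_adj adj) (Some ` pverts G) l r d u"
    using box_rep_if_start_layout[OF _ _ symp] by blast
  then show ?thesis
    by (rule B0_VPG_if_box_rep) (auto simp: lift_adj_def adj)
qed

end
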